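(* Let $\rho=(r_n)_n$ be an increasing sequence in $[0,1)$ with $r_n\to1$ as $n\to\infty$. Let $w\in\mathbb{D}\setminus\{0\}$ and let $\Phi:\mathbb{D}\to\mathbb{D}$ be holomorphic and continuous on $\overline{\mathbb{D}}$ (i.e. $\Phi$ extends continuously to $\overline{\mathbb{D}}$). Then $f\circ\Phi$ belongs to $\mathcal{U}_A^w(\mathbb{D})$ for every $f\in\mathcal{U}_A^w(\mathbb{D},\rho)$ if and only if $\Phi$ is the identity map.
   Context: $\mathbb{D}$ is the open unit disc, $\mathbb{T}=\partial\mathbb{D}$ the unit circle, and $H(\mathbb{D})$ the space of holomorphic functions on $\mathbb{D}$. For $w\in\mathbb{D}$ and an increasing sequence $\rho=(r_n)_n$ in $[0,1)$ with $r_n\to1$, $\mathcal{U}_A^w(\mathbb{D},\rho)$ (the $w$-Abel universal functions) denotes the set of all $f\in H(\mathbb{D})$ such that: for any compact subset $K\subset\mathbb{T}$, $K\neq\mathbb{T}$, and any continuous function $\varphi:K\to\mathbb{C}$, there exists an increasing sequence $(n_k)_k$ in $\mathbb{N}$ such that $\sup_{\zeta\in K}|f(w+r_{n_k}(\zeta-w))-\varphi(\zeta)|\to0$ as $k\to\infty$. Moreover $\mathcal{U}_A^w(\mathbb{D})=\bigcup_\rho\mathcal{U}_A^w(\mathbb{D},\rho)$, where $\rho$ varies over all increasing sequences in $[0,1)$ tending to $1$. *)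

theory Defs
  imports "HOL-Complex_Analysis.Complex_Analysis"
begin

text \<open>
  Sequences of radii are increasing in the weak sense. As they stay below the limit 1,
  every value is attained only finitely often, so requiring strict monotonicity
  would give the same union over all radii below.
\<close>

definition abel_radii :: "(nat \<Rightarrow> real) \<Rightarrow> bool" where
  "abel_radii r \<longleftrightarrow> incseq r \<and> (\<forall>n. 0 \<le> r n \<and> r n < 1) \<and> r \<longlonglongrightarrow> 1"

text \<open>
  Membership depends only on the values of \<open>f\<close> on the open unit disc: the point
  \<open>w + r n * (\<zeta> - w)\<close> lies there whenever \<open>w\<close> does, \<open>r n\<close> is in \<open>[0, 1)\<close> and \<open>\<zeta>\<close>
  is on the unit circle. The convergence to 0 of the suprema over \<open>K\<close> is \<^const>\<open>uniform_limit\<close>,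
  which also covers the empty \<open>K\<close>.
\<close>

definition abel_universal_wrt :: "complex \<Rightarrow> (nat \<Rightarrow> real) \<Rightarrow> (complex \<Rightarrow> complex) set" where
  "abel_universal_wrt w r =
     {f. f holomorphic_on ball 0 1 \<and>
         (\<forall>K \<phi>. compact K \<and> K \<subseteq> sphere 0 1 \<and> K \<noteq> sphere 0 1 \<and> continuous_on K \<phi> \<longrightarrow>
            (\<exists>n::nat \<Rightarrow> nat. strict_mono n \<and>
               uniform_limit K (\<lambda>k \<zeta>. f (w + of_real (r (n k)) * (\<zeta> - w))) \<phi> sequentially))}"

definition abel_universal :: "complex \<Rightarrow> (complex \<Rightarrow> complex) set" where
  "abel_universal w = (\<Union>r\<in>{r. abel_radii r}. abel_universal_wrt w r)"

end

theory Submission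
  imports Defs "HOL-Computational_Algebra.Fundamental_Theorem_Algebra"
begin

text \<open>
  Write \<open>\<phi>\<^sub>t(\<zeta>) = w + t (\<zeta> - w)\<close> and \<open>C\<^sub>t\<close> for the image of the unit circle under \<open>\<phi>\<^sub>t\<close>. If
  every \<open>f \<circ> \<Phi>\<close> is universal, the continuous extension of \<open>\<Phi>\<close> has modulus 1 on
  the circle, since otherwise \<open>f \<circ> \<Phi>\<close> has a limit at a boundary point. Fix a small arc \<open>K\<close>.

  Suppose that for infinitely many \<open>n\<close> no curve \<open>\<Phi>(\<phi>\<^sub>t(K))\<close> lies on \<open>C\<^bsub>r n\<^esub>\<close>. By
  compactness none lies in a sufficiently thin shell around \<open>C\<^bsub>r n\<^esub>\<close>. Runge-type approximation
  yields a universal \<open>f\<close> that is bounded, near \<open>\<Phi>(K)\<close>, outside such thin disjoint shells. If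
  \<open>f \<circ> \<Phi>\<close> were close to a large constant on \<open>\<phi>\<^sub>t(K)\<close>, the connected curve \<open>\<Phi>(\<phi>\<^sub>t(K))\<close> would
  lie in a single shell, a contradiction.

  Otherwise \<open>\<Phi>\<close> maps an arc of some \<open>C\<^sub>t\<close> into \<open>C\<^bsub>r n\<^esub>\<close> for almost all \<open>n\<close>. A Moebius map turns
  the unit circle and \<open>C\<^sub>t\<close> into concentric circles; repeated reflection then shows that \<open>\<Phi>\<close>
  maps the limit point of the pencil of \<open>C\<^sub>t\<close> and the unit circle to that of the pencil of
  \<open>C\<^bsub>r n\<^esub>\<close> and the unit circle, and that either the two points agree or \<open>\<Phi>\<close> is critical
  at the first. These points accumulate inside the disc, so
  \<open>\<Phi>\<close> is the identity (being constant is impossible).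
\<close>

section \<open>Uniform approximation by polynomials\<close>

definition poly_approx_on :: "complex set \<Rightarrow> (complex \<Rightarrow> complex) \<Rightarrow> bool" where
  "poly_approx_on X f \<longleftrightarrow> (\<forall>\<epsilon>>0. \<exists>p. \<forall>z\<in>X. norm (poly p z - f z) < \<epsilon>)"

lemma poly_approx_onD:
  assumes "poly_approx_on X f" "\<epsilon> > 0"
  obtains p where "\<And>z. z \<in> X \<Longrightarrow> norm (poly p z - f z) < \<epsilon>"
  using assms unfolding poly_approx_on_def by blast

lemma poly_approx_on_limit:
  assumes "\<And>\<epsilon>. \<epsilon> > 0 \<Longrightarrow> \<exists>g. poly_approx_on X g \<and> (\<forall>z\<in>X. norm (g z - f z) < \<epsilon>)"
  shows "poly_approx_on X f"
  unfolding poly_approx_on_def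
proof (intro allI impI)
  fix \<epsilon> :: real assume "\<epsilon> > 0"
  then obtain g where g: "poly_approx_on X g" "\<And>z. z \<in> X \<Longrightarrow> norm (g z - f z) < \<epsilon>/2"
    using assms[of "\<epsilon>/2"] by auto
  obtain p where p: "\<And>z. z \<in> X \<Longrightarrow> norm (poly p z - g z) < \<epsilon>/2"
    using poly_approx_onD[OF g(1), of "\<epsilon>/2"] \<open>\<epsilon> > 0\<close> by auto
  have "norm (poly p z - f z) < \<epsilon>" if "z \<in> X" for z
    using norm_diff_triangle_less[OF p[OF that] g(2)[OF that]] by simp
  then show "\<exists>p. \<forall>z\<in>X. norm (poly p z - f z) < \<epsilon>" by blast
qed

lemma poly_approx_on_cong:
  assumes "\<And>z. z \<in> X \<Longrightarrow> f z = g z"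
  shows "poly_approx_on X f \<longleftrightarrow> poly_approx_on X g"
  unfolding poly_approx_on_def using assms by (metis (no_types, lifting))

lemma poly_approx_on_poly: "poly_approx_on X (poly p)"
  unfolding poly_approx_on_def by (metis diff_self norm_zero)

lemma poly_approx_on_const: "poly_approx_on X (\<lambda>z. c)"
  using poly_approx_on_poly[of X "[:c:]"] by (simp add: poly_approx_on_def)

lemma poly_approx_on_ident: "poly_approx_on X (\<lambda>z. z)"
  using poly_approx_on_poly[of X "[:0, 1:]"] by (simp add: poly_approx_on_def)

lemma poly_approx_on_add:
  assumes "poly_approx_on X f" "poly_approx_on X g"
  shows "poly_approx_on X (\<lambda>z. f z + g z)"
  unfolding poly_approx_on_def
proof (intro allI impI)
  fix \<epsilon> :: real assume "\<epsilon> > 0"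
  obtain p where p: "\<And>z. z \<in> X \<Longrightarrow> norm (poly p z - f z) < \<epsilon>/2"
    using poly_approx_onD[OF assms(1), of "\<epsilon>/2"] \<open>\<epsilon> > 0\<close> by auto
  obtain q where q: "\<And>z. z \<in> X \<Longrightarrow> norm (poly q z - g z) < \<epsilon>/2"
    using poly_approx_onD[OF assms(2), of "\<epsilon>/2"] \<open>\<epsilon> > 0\<close> by auto
  have "norm (poly (p + q) z - (f z + g z)) < \<epsilon>" if "z \<in> X" for z
    using norm_diff_ineq norm_add_less[OF p[OF that] q[OF that]] by (simp add: algebra_simps)
  then show "\<exists>p. \<forall>z\<in>X. norm (poly p z - (f z + g z)) < \<epsilon>" by blast
qed

lemma poly_approx_on_bounded:
  assumes "compact X" "poly_approx_on X f"
  obtains M where "M > 0" "\<And>z. z \<in> X \<Longrightarrow> norm (f z) \<le> M"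
proof -
  obtain p where p: "\<And>z. z \<in> X \<Longrightarrow> norm (poly p z - f z) < 1"
    using poly_approx_onD[OF assms(2), of 1] by auto
  have "compact (poly p ` X)"
    by (intro compact_continuous_image assms continuous_intros)
  then obtain M where M: "\<And>z. z \<in> X \<Longrightarrow> norm (poly p z) \<le> M"
    by (metis compact_imp_bounded bounded_iff imageI)
  have "norm (f z) \<le> \<bar>M\<bar> + 1" if "z \<in> X" for z
    using p[OF that] M[OF that] norm_triangle_ineq2[of "f z" "poly p z"]
    by (simp add: norm_minus_commute)
  then show ?thesis using that[of "\<bar>M\<bar> + 1"] by force
qed

lemma poly_approx_on_mult:
  assumes X: "compact X" and f: "poly_approx_on X f" and g: "poly_approx_on X g"
  shows "poly_approx_on X (\<lambda>z. f z * g z)"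
  unfolding poly_approx_on_def
proof (intro allI impI)
  fix \<epsilon> :: real assume e: "\<epsilon> > 0"
  obtain M where M: "M > 0" "\<And>z. z \<in> X \<Longrightarrow> norm (f z) \<le> M"
    using poly_approx_on_bounded[OF X f] by blast
  obtain q where q: "\<And>z. z \<in> X \<Longrightarrow> norm (poly q z - g z) < \<epsilon>/2/M"
    using poly_approx_onD[OF g, of "\<epsilon>/2/M"] e M by auto
  obtain L where L: "L > 0" "\<And>z. z \<in> X \<Longrightarrow> norm (poly q z) \<le> L"
    using poly_approx_on_bounded[OF X poly_approx_on_poly] by blast
  \<comment> \<open>The tolerance for \<open>p\<close> involves the bound \<open>L\<close> of the
    polynomial \<open>q\<close>, so \<open>q\<close> has to be fixed first.\<close>
  obtain p where p: "\<And>z. z \<in> X \<Longrightarrow> norm (poly p z - f z) < \<epsilon>/2/L"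
    using poly_approx_onD[OF f, of "\<epsilon>/2/L"] e L by auto
  have "norm (poly (p * q) z - f z * g z) < \<epsilon>" if z: "z \<in> X" for z
  proof -
    have "poly (p * q) z - f z * g z = (poly p z - f z) * poly q z + f z * (poly q z - g z)"
      by (simp add: algebra_simps)
    also have "norm \<dots> \<le> norm (poly p z - f z) * norm (poly q z) + norm (f z) * norm (poly q z - g z)"
      by (metis norm_mult norm_triangle_ineq)
    also have "norm (poly p z - f z) * norm (poly q z) \<le> norm (poly p z - f z) * L"
      by (simp add: L z mult_left_mono)
    also have "norm (f z) * norm (poly q z - g z) \<le> M * norm (poly q z - g z)"
      by (simp add: M z mult_right_mono)
    also have "norm (poly p z - f z) * L < \<epsilon>/2"
      using p[OF z] L(1) by (simp add: field_simps)
    also have "M * norm (poly q z - g z) < \<epsilon>/2"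
      using q[OF z] M(1) by (simp add: field_simps)
    finally show ?thesis by simp
  qed
  then show "\<exists>p. \<forall>z\<in>X. norm (poly p z - f z * g z) < \<epsilon>" by blast
qed

lemma poly_approx_on_diff:
  assumes "compact X" "poly_approx_on X f" "poly_approx_on X g"
  shows "poly_approx_on X (\<lambda>z. f z - g z)"
  using poly_approx_on_add[OF assms(2) poly_approx_on_mult[OF assms(1) poly_approx_on_const[of X "-1"] assms(3)]]
  by simp

lemma poly_approx_on_power:
  assumes "compact X" "poly_approx_on X f"
  shows "poly_approx_on X (\<lambda>z. f z ^ n)"
  by (induction n) (auto intro: poly_approx_on_const poly_approx_on_mult assms)

lemma poly_approx_on_sum:
  assumes "\<And>i. i \<in> I \<Longrightarrow> poly_approx_on X (f i)"
  shows "poly_approx_on X (\<lambda>z. \<Sum>i\<in>I. f i z)"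
  using assms by (induction I rule: infinite_finite_induct) (auto intro: poly_approx_on_const poly_approx_on_add)

section \<open>Geometric series and the pushing of poles\<close>

lemma poly_approx_on_geometric:
  assumes X: "compact X" and f: "poly_approx_on X f"
    and c: "c < 1" "\<And>z. z \<in> X \<Longrightarrow> norm (f z) \<le> c"
  shows "poly_approx_on X (\<lambda>z. 1 / (1 - f z))"
proof (rule poly_approx_on_limit)
  fix \<epsilon> :: real assume e: "\<epsilon> > 0"
  \<comment> \<open>For empty \<open>X\<close> the constant \<open>c\<close> may be negative, while
    the power estimates want a nonnegative ratio.\<close>
  define c' where "c' = max c 0"
  have c': "0 \<le> c'" "c' < 1" "\<And>z. z \<in> X \<Longrightarrow> norm (f z) \<le> c'"
    using c unfolding c'_def by force+
  have "(\<lambda>n. c' ^ n / (1 - c')) \<longlonglongrightarrow> 0 / (1 - c')"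
    using c' by (intro tendsto_intros LIMSEQ_power_zero) auto
  then have "\<forall>\<^sub>F n in sequentially. c' ^ n / (1 - c') < \<epsilon>"
    using e by (simp add: order_tendsto_iff)
  from eventually_happens'[OF sequentially_bot this]
  obtain n where n: "c' ^ n / (1 - c') < \<epsilon>" by blast
  have "norm ((\<Sum>i<n. f z ^ i) - 1 / (1 - f z)) < \<epsilon>" if z: "z \<in> X" for z
  proof -
    have le: "norm (f z) \<le> c'" using c' z by simp
    have ne: "f z \<noteq> 1" using le c' by auto
    have "(\<Sum>i<n. f z ^ i) - 1 / (1 - f z) = - (f z ^ n / (1 - f z))"
      using ne by (simp add: sum_gp_strict diff_divide_distrib)
    also have "norm \<dots> = norm (f z) ^ n / norm (1 - f z)"
      by (simp add: norm_divide norm_power)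
    also have "\<dots> \<le> c' ^ n / (1 - c')"
    proof (intro frac_le power_mono le)
      show "1 - c' \<le> norm (1 - f z)"
        using norm_triangle_ineq2[of 1 "f z"] le by simp
    qed (use c' in auto)
    finally show ?thesis using n by simp
  qed
  then show "\<exists>g. poly_approx_on X g \<and> (\<forall>z\<in>X. norm (g z - 1 / (1 - f z)) < \<epsilon>)"
    by (intro exI[of _ "\<lambda>z. \<Sum>i<n. f z ^ i"] conjI poly_approx_on_sum poly_approx_on_power X f) auto
qed

text \<open>Since \<open>1 / (z - u)\<close> is \<open>- 1 / u\<close> times
  \<open>1 / (1 - z / u)\<close>, a geometric series with ratio at most 1/2 applies.\<close>

lemma poly_approx_on_pole_far:
  assumes X: "compact X" and u: "\<And>z. z \<in> X \<Longrightarrow> 2 * norm z \<le> norm u" "u \<noteq> 0"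
  shows "poly_approx_on X (\<lambda>z. 1 / (z - u))"
proof -
  have "poly_approx_on X (\<lambda>z. (- 1 / u) * (1 / (1 - (1/u) * z)))"
  proof (intro poly_approx_on_mult poly_approx_on_const X poly_approx_on_geometric[where c = "1/2"]
      poly_approx_on_ident)
    show "norm ((1 / u) * z) \<le> 1/2" if "z \<in> X" for z
      using u(1)[OF that] u(2) by (simp add: norm_mult norm_divide field_simps)
  qed auto
  moreover have "(- 1 / u) * (1 / (1 - (1/u) * z)) = 1 / (z - u)" for z
  proof -
    have "(- 1 / u) * (1 / (1 - (1 / u) * z)) = 1 / (- (u * (1 - (1 / u) * z)))"
      by simp
    also have "- (u * (1 - (1 / u) * z)) = z - u" using u(2) by (simp add: algebra_simps)
    finally show ?thesis .
  qed
  ultimately show ?thesis by simp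
qed

text \<open>The factorization \<open>z - y = (z - x) * (1 - (y - x) / (z - x))\<close> expands the
  new pole in a geometric series in powers of the old one. A pole can thus be moved by any amount
  below its distance from \<open>X\<close>.\<close>

lemma poly_approx_on_pole_near:
  assumes X: "compact X" and x: "poly_approx_on X (\<lambda>z. 1 / (z - x))"
    and d: "d > 0" "\<And>z. z \<in> X \<Longrightarrow> d \<le> norm (z - x)" and y: "norm (y - x) < d"
  shows "poly_approx_on X (\<lambda>z. 1 / (z - y))"
proof -
  have "poly_approx_on X (\<lambda>z. (1 / (z - x)) * (1 / (1 - (y - x) * (1 / (z - x)))))"
  proof (intro poly_approx_on_mult poly_approx_on_const X x
      poly_approx_on_geometric[where c = "norm (y - x) / d"])
    show "norm (y - x) / d < 1" using y d by simp
    show "norm ((y - x) * (1 / (z - x))) \<le> norm (y - x) / d" if "z \<in> X" for z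
      using d(1) d(2)[OF that] by (simp add: norm_mult norm_divide frac_le)
  qed
  moreover have "(1 / (z - x)) * (1 / (1 - (y - x) * (1 / (z - x)))) = 1 / (z - y)" if "z \<in> X" for z
  proof -
    have "z \<noteq> x" using d(1) d(2)[OF that] by auto
    then show ?thesis by (simp add: divide_simps)
  qed
  ultimately show ?thesis by (simp cong: poly_approx_on_cong)
qed

text \<open>Runge's pole pushing: some point of the unbounded set \<open>N\<close> is far enough
  from \<open>X\<close> for the direct expansion, and approximability is locally constant along
  \<open>N\<close>, so connectedness carries it to \<open>u\<close>.\<close>

lemma poly_approx_on_pole:
  assumes X: "compact X" and N: "connected N" "N \<inter> X = {}" "\<not> bounded N" and u: "u \<in> N"
  shows "poly_approx_on X (\<lambda>z. 1 / (z - u))"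
proof (cases "X = {}")
  case True
  then show ?thesis by (simp add: poly_approx_on_def)
next
  case False
  obtain B where B: "\<And>z. z \<in> X \<Longrightarrow> norm z \<le> B"
    using X compact_imp_bounded bounded_iff by metis
  obtain a where a: "a \<in> N" "norm a > 2 * \<bar>B\<bar>"
    using N(3) by (meson bounded_iff linorder_not_less)
  have "poly_approx_on X (\<lambda>z. 1 / (z - a))"
    by (rule poly_approx_on_pole_far[OF X]) (use a B in force)+
  then show ?thesis
  proof (rule connected_induction_simple[OF N(1) a(1) u])
    fix b assume b: "b \<in> N"
    define d where "d = infdist b X"
    have d: "d > 0"
      unfolding d_def using b N(2) False X
      by (intro infdist_pos_not_in_closed compact_imp_closed) auto
    have le: "d \<le> norm (z - b)" if "z \<in> X" for z
      unfolding d_def using infdist_le[OF that, of b] by (simp add: dist_norm norm_minus_commute)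
    \<comment> \<open>Two points of \<open>T\<close> are less than \<open>2*d/3\<close> apart and
      each keeps distance at least \<open>2*d/3\<close> from \<open>X\<close>, so the pole may jump
      between them.\<close>
    define T where "T = N \<inter> ball b (d/3)"
    have "openin (top_of_set N) T" "b \<in> T"
      using b d by (auto simp: T_def)
    moreover have "poly_approx_on X (\<lambda>z. 1 / (z - y))"
      if xy: "x \<in> T" "y \<in> T" "poly_approx_on X (\<lambda>z. 1 / (z - x))" for x y
    proof (rule poly_approx_on_pole_near[OF X xy(3)])
      have bx: "norm (b - x) < d/3" "norm (b - y) < d/3"
        using xy(1,2) by (auto simp: T_def dist_norm)
      show "2*d/3 \<le> norm (z - x)" if "z \<in> X" for z
        using le[OF that] norm_triangle_ineq[of "z - x" "x - b"] bx
        by (simp add: norm_minus_commute)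
      show "norm (y - x) < 2*d/3"
        using norm_triangle_ineq[of "y - b" "b - x"] bx by (simp add: norm_minus_commute)
    qed (use d in auto)
    ultimately show "\<exists>T. openin (top_of_set N) T \<and> b \<in> T \<and>
        (\<forall>x\<in>T. \<forall>y\<in>T. poly_approx_on X (\<lambda>z. 1 / (z - x)) \<longrightarrow> poly_approx_on X (\<lambda>z. 1 / (z - y)))"
      by blast
  qed
qed

text \<open>Over the complex numbers \<open>q\<close> splits, so its reciprocal is a product of
  simple poles at the roots and a constant. Each induction step splits off one root.\<close>

lemma poly_approx_on_inverse_poly:
  assumes X: "compact X" and q: "q \<noteq> 0"
    and pole: "\<And>u. poly q u = 0 \<Longrightarrow> poly_approx_on X (\<lambda>z. 1 / (z - u))"
  shows "poly_approx_on X (\<lambda>z. 1 / poly q z)"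
  using q pole
proof (induction "degree q" arbitrary: q)
  case 0
  then obtain c where "q = [:c:]" by (metis degree_eq_zeroE)
  then show ?case by (simp add: poly_approx_on_const)
next
  case (Suc n)
  then obtain u where u: "poly q u = 0"
    using alg_closed_imp_poly_has_root[of q] by auto
  then obtain p where p: "q = [:-u, 1:] * p" by (auto simp: poly_eq_0_iff_dvd)
  have "p \<noteq> 0" using p Suc.prems by auto
  then have "degree q = Suc (degree p)"
    unfolding p by (subst degree_mult_eq) auto
  then have "poly_approx_on X (\<lambda>z. 1 / poly p z)"
    using Suc \<open>p \<noteq> 0\<close> by (intro Suc.hyps(1)) (auto simp: p)
  then have "poly_approx_on X (\<lambda>z. (1 / (z - u)) * (1 / poly p z))"
    by (intro poly_approx_on_mult X Suc.prems(2) u)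
  then show ?case by (simp add: p left_diff_distrib)
qed

text \<open>
  The indicator function of a disc is a uniform limit, away from the bounding circle, of
  \<open>1 / (1 + ((z - c) / \<rho>) ^ n)\<close>, whose poles lie on that circle.
\<close>
lemma poly_approx_on_indicator_ball:
  assumes X: "compact X" and \<rho>: "\<rho> > 0" and disj: "X \<inter> sphere c \<rho> = {}"
    and pole: "\<And>u. u \<in> sphere c \<rho> \<Longrightarrow> poly_approx_on X (\<lambda>z. 1 / (z - u))"
  shows "poly_approx_on X (indicator (ball c \<rho>))"
proof (cases "X = {}")
  case True
  then show ?thesis by (simp add: poly_approx_on_def)
next
  case False
  define v where "v z = (z - c) / of_real \<rho>" for z
  obtain z0 where z0: "z0 \<in> X" "\<And>z. z \<in> X \<Longrightarrow> \<bar>norm (v z0) - 1\<bar> \<le> \<bar>norm (v z) - 1\<bar>"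
  proof -
    have "continuous_on X (\<lambda>z. \<bar>norm (v z) - 1\<bar>)"
      unfolding v_def using \<rho> by (auto intro!: continuous_intros)
    from continuous_attains_inf[OF X False this] show ?thesis using that by blast
  qed
  define d where "d = \<bar>norm (v z0) - 1\<bar>"
  have nv: "norm (v z) = norm (z - c) / \<rho>" for z
    using \<rho> by (simp add: v_def norm_divide)
  have d: "d > 0"
    using z0(1) disj \<rho> by (auto simp: d_def nv dist_norm norm_minus_commute)
  have inb: "z \<in> ball c \<rho> \<longleftrightarrow> norm (v z) < 1" for z
    using \<rho> by (simp add: nv dist_norm norm_minus_commute)
  have inner: "norm (v z) \<le> 1 - d" if "z \<in> X" "z \<in> ball c \<rho>" for z
    using z0(2)[OF that(1)] that(2) unfolding d_def inb by linarith
  have outer: "norm (v z) \<ge> 1 + d" if "z \<in> X" "z \<notin> ball c \<rho>" for z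
    using z0(2)[OF that(1)] that(2) unfolding d_def inb by linarith
  define q where "q n = 1 + [:- c / of_real \<rho>, 1 / of_real \<rho>:] ^ n" for n
  have q: "poly (q n) z = 1 + v z ^ n" for n z
    by (simp add: q_def v_def poly_power diff_divide_distrib)
  have approx: "poly_approx_on X (\<lambda>z. 1 / (1 + v z ^ n))" if "n > 0" for n
  proof -
    have "poly (q n) c = 1" using \<open>n > 0\<close> by (simp add: q v_def)
    then have "q n \<noteq> 0" by auto
    then have "poly_approx_on X (\<lambda>z. 1 / poly (q n) z)"
    proof (rule poly_approx_on_inverse_poly[OF X])
      fix u assume "poly (q n) u = 0"
      then have "v u ^ n = -1" by (simp add: q add_eq_0_iff)
      then have "norm (v u) ^ n = 1" by (metis norm_minus_cancel norm_one norm_power)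
      then have "norm (v u) = 1" using \<open>n > 0\<close> by (metis norm_ge_zero power_eq_1_iff neq0_conv abs_of_nonneg real_norm_def)
      then show "poly_approx_on X (\<lambda>z. 1 / (z - u))"
        using \<rho> by (intro pole) (simp add: nv dist_norm norm_minus_commute)
    qed
    then show ?thesis by (simp add: q)
  qed
  show ?thesis
  proof (rule poly_approx_on_limit)
    fix \<epsilon> :: real assume e: "\<epsilon> > 0"
    \<comment> \<open>One ratio serves both sides of the circle: \<open>norm (v z)\<close> is at
      most \<open>a\<close> inside and at least \<open>1 / a\<close> outside, and both cases lead to
      the error \<open>a ^ n / (1 - a ^ n)\<close>.\<close>
    define a where "a = max (1 - d) (1 / (1 + d))"
    have a: "0 < a" "a < 1" "1 - d \<le> a" "1 \<le> a * (1 + d)"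
      using d by (auto simp: a_def less_max_iff_disj max_def field_simps)
    have "(\<lambda>n. a ^ n / (1 - a ^ n)) \<longlonglongrightarrow> 0 / (1 - 0)"
      using a by (intro tendsto_intros LIMSEQ_power_zero) auto
    then have "\<forall>\<^sub>F n in sequentially. a ^ n / (1 - a ^ n) < \<epsilon>"
      using e by (simp add: order_tendsto_iff)
    then have "\<forall>\<^sub>F n in sequentially. a ^ n / (1 - a ^ n) < \<epsilon> \<and> n > 0"
      by (intro eventually_conj eventually_gt_at_top)
    from eventually_happens'[OF sequentially_bot this]
    obtain n where n: "a ^ n / (1 - a ^ n) < \<epsilon>" "n > 0" by blast
    have an: "0 < a ^ n" "a ^ n < 1" using a n by (auto simp: power_less_one_iff)
    have "norm (1 / (1 + v z ^ n) - indicator (ball c \<rho>) z) < \<epsilon>" if z: "z \<in> X" for z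
    proof (cases "z \<in> ball c \<rho>")
      case True
      have le: "norm (v z ^ n) \<le> a ^ n"
        using inner[OF z True] a by (simp add: norm_power power_mono)
      have ge: "1 - a ^ n \<le> norm (1 + v z ^ n)"
        using norm_triangle_ineq2[of 1 "- (v z ^ n)"] le by simp
      have "1 / (1 + v z ^ n) - indicator (ball c \<rho>) z = - (v z ^ n / (1 + v z ^ n))"
      proof -
        have "1 + v z ^ n \<noteq> 0" using ge an by auto
        then have "1 / (1 + v z ^ n) - 1 = - (v z ^ n / (1 + v z ^ n))" by (simp add: divide_simps)
        then show ?thesis using True by simp
      qed
      also have "norm \<dots> \<le> a ^ n / (1 - a ^ n)"
        unfolding norm_minus_cancel norm_divide using le ge an by (intro frac_le) auto
      finally show ?thesis using n by simp
    next
      case False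
      have "1 \<le> a * norm (v z)"
        using mult_left_mono[OF outer[OF z False], of a] a by linarith
      then have "1 \<le> a ^ n * norm (v z) ^ n"
        by (metis one_le_power power_mult_distrib)
      then have nn: "1 / a ^ n \<le> norm (v z ^ n)" using an by (simp add: norm_power field_simps)
      have ge: "1 / a ^ n - 1 \<le> norm (1 + v z ^ n)"
        using norm_triangle_ineq2[of "v z ^ n" "-1"] nn by (simp add: add.commute)
      have pos: "0 < 1 / a ^ n - 1" using an by (simp add: field_simps)
      have "norm (1 / (1 + v z ^ n) - indicator (ball c \<rho>) z) = 1 / norm (1 + v z ^ n)"
        using False by (simp add: norm_divide)
      also have "\<dots> \<le> 1 / (1 / a ^ n - 1)"
        using ge pos by (intro frac_le) auto
      also have "\<dots> = a ^ n / (1 - a ^ n)" using an a(1) by (simp add: field_simps)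
      finally show ?thesis using n by simp
    qed
    then show "\<exists>g. poly_approx_on X g \<and> (\<forall>z\<in>X. norm (g z - indicator (ball c \<rho>) z) < \<epsilon>)"
      using approx[OF n(2)] by blast
  qed
qed

text \<open>
  On a proper closed subset of the circle \<open>1 / z\<close>, which equals the conjugate of \<open>z\<close>, is a uniform
  limit of polynomials: its pole can be pushed from 0 to infinity along a ray missing the set.
\<close>
lemma poly_approx_on_circle_subset:
  assumes K: "compact K" "K \<subseteq> sphere 0 1" "K \<noteq> sphere 0 1" and \<phi>: "continuous_on K \<phi>"
  shows "poly_approx_on K \<phi>"
proof -
  obtain \<eta> where \<eta>: "norm \<eta> = 1" "\<eta> \<notin> K" using K(2,3) by fastforce
  \<comment> \<open>The ray from 0 through the omitted point \<open>\<eta>\<close> meets the unit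
    circle only in \<open>\<eta>\<close>.\<close>
  define N where "N = (\<lambda>t. of_real t * \<eta>) ` {0..}"
  have "poly_approx_on K (\<lambda>z. 1 / (z - 0))"
  proof (rule poly_approx_on_pole[OF K(1), of N])
    show "connected N" unfolding N_def
      by (intro connected_continuous_image continuous_intros) auto
    show "N \<inter> K = {}"
    proof -
      have False if "t \<ge> 0" "of_real t * \<eta> \<in> K" for t :: real
      proof -
        have "norm (of_real t * \<eta>) = 1" using that K(2) by auto
        then have "t = 1" using that \<eta> by (simp add: norm_mult)
        then show False using that \<eta> by simp
      qed
      then show ?thesis by (auto simp: N_def)
    qed
    have "\<exists>z\<in>N. norm z > B" for B
    proof
      show "of_real (\<bar>B\<bar> + 1) * \<eta> \<in> N" unfolding N_def by (rule imageI) simp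
      show "norm (of_real (\<bar>B\<bar> + 1) * \<eta>) > B" by (simp only: norm_mult norm_of_real \<eta>) simp
    qed
    then show "\<not> bounded N" by (meson bounded_iff linorder_not_le)
    show "0 \<in> N" by (auto simp: N_def image_iff intro!: bexI[of _ 0])
  qed
  moreover have "1 / (z - 0) = cnj z" if "z \<in> K" for z
  proof -
    have n: "norm z = 1" using that K(2) by auto
    have "z * cnj z = 1" using complex_norm_square[of z] n by simp
    moreover have "z \<noteq> 0" using n by auto
    ultimately show ?thesis by (simp add: field_simps)
  qed
  ultimately have cnj: "poly_approx_on K cnj" by (simp cong: poly_approx_on_cong)
  \<comment> \<open>Stone-Weierstrass is applied to the real functions that complex polynomials
    approximate on \<open>K\<close>. Approximability of the conjugate puts \<open>Re\<close> and
    \<open>Im\<close> into this class, and these separate points.\<close>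
  define P where "P g \<longleftrightarrow> continuous_on K g \<and> poly_approx_on K (\<lambda>z. of_real (g z))" for g
  have Re: "P Re"
  proof -
    have "poly_approx_on K (\<lambda>z. (1/2) * (z + cnj z))"
      by (intro poly_approx_on_mult poly_approx_on_add K poly_approx_on_const poly_approx_on_ident cnj)
    moreover have "(1/2) * (z + cnj z) = of_real (Re z)" for z by (simp add: complex_eq_iff)
    ultimately show ?thesis unfolding P_def by (auto intro!: continuous_intros)
  qed
  have Im: "P Im"
  proof -
    have "poly_approx_on K (\<lambda>z. (- \<i>/2) * (z - cnj z))"
      by (intro poly_approx_on_mult poly_approx_on_diff K poly_approx_on_const poly_approx_on_ident cnj)
    moreover have "(- \<i>/2) * (z - cnj z) = of_real (Im z)" for z by (simp add: complex_eq_iff)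
    ultimately show ?thesis unfolding P_def by (auto intro!: continuous_intros)
  qed
  have real: "poly_approx_on K (\<lambda>z. of_real (g z))" if g: "continuous_on K g" for g :: "complex \<Rightarrow> real"
  proof (rule poly_approx_on_limit)
    fix \<epsilon> :: real assume e: "\<epsilon> > 0"
    have "\<exists>h. P h \<and> (\<forall>x\<in>K. \<bar>g x - h x\<bar> < \<epsilon>)"
    proof (rule Stone_Weierstrass_HOL[OF K(1) _ _ _ _ _ g e])
      show "\<exists>f. P f \<and> f x \<noteq> f y" if "x \<in> K \<and> y \<in> K \<and> x \<noteq> y" for x y
        using that Re Im complex_eqI by blast
    qed (auto simp: P_def intro: continuous_intros poly_approx_on_const poly_approx_on_add
        poly_approx_on_mult K)
    then obtain h where "P h" "\<forall>x\<in>K. \<bar>g x - h x\<bar> < \<epsilon>" by blast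
    then show "\<exists>h. poly_approx_on K h \<and> (\<forall>z\<in>K. norm (h z - of_real (g z)) < \<epsilon>)"
      unfolding P_def
      by (intro exI[of _ "\<lambda>z. of_real (h z)"]) 
        (auto simp flip: of_real_diff simp: abs_minus_commute)
  qed
  have "poly_approx_on K (\<lambda>z. of_real (Re (\<phi> z)) + \<i> * of_real (Im (\<phi> z)))"
    by (intro poly_approx_on_add poly_approx_on_mult poly_approx_on_const K real continuous_intros \<phi>)
  then show ?thesis by (simp flip: complex_eq)
qed

section \<open>Universal functions bounded off thin shells\<close>

abbreviation abel_centre :: "complex \<Rightarrow> real \<Rightarrow> complex" where
  "abel_centre w t \<equiv> (1 - of_real t) * w"

definition abel_map :: "complex \<Rightarrow> real \<Rightarrow> complex \<Rightarrow> complex" where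
  "abel_map w t \<zeta> = w + of_real t * (\<zeta> - w)"

lemma abel_map_alt: "abel_map w t \<zeta> = abel_centre w t + of_real t * \<zeta>"
  by (simp add: abel_map_def algebra_simps)

lemma abel_map_on_sphere:
  assumes "norm \<zeta> = 1" "0 \<le> t"
  shows "abel_map w t \<zeta> \<in> sphere (abel_centre w t) t"
  using assms by (simp add: abel_map_alt dist_norm norm_mult)

lemma abel_map_surj_sphere:
  assumes "z \<in> sphere (abel_centre w t) t" "0 < t"
  obtains \<zeta> where "norm \<zeta> = 1" "z = abel_map w t \<zeta>"
proof
  define \<zeta> where "\<zeta> = (z - abel_centre w t) / of_real t"
  show "norm \<zeta> = 1" using assms by (simp add: \<zeta>_def norm_divide dist_norm norm_minus_commute)
  show "z = abel_map w t \<zeta>" using assms by (simp add: abel_map_alt \<zeta>_def)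
qed

text \<open>The centres are \<open>(t - s) * norm w\<close> apart, which is strictly less than the
  difference \<open>t - s\<close> of the radii.\<close>

lemma abel_disc_nested:
  assumes "norm w < 1" "s < t" "z \<in> cball (abel_centre w s) s"
  shows "z \<in> ball (abel_centre w t) t"
proof -
  have "abel_centre w t - abel_centre w s = of_real (s - t) * w" by (simp add: algebra_simps)
  then have d: "dist (abel_centre w t) (abel_centre w s) = (t - s) * norm w"
    unfolding dist_norm using assms by (simp only: norm_mult norm_of_real) simp
  have "(t - s) * norm w < t - s" using assms by simp
  then show ?thesis
    using dist_triangle[of "abel_centre w t" z "abel_centre w s"] d assms(3) by simp
qed

lemma abel_disc_in_unit_disc:
  assumes "norm w < 1" "t < 1" "z \<in> cball (abel_centre w t) t"
  shows "norm z < 1"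
  using abel_disc_nested[OF assms(1,2,3)] by simp

text \<open>Used also for \<open>t > 1\<close>, hence the absolute value: the ray
  \<open>t \<mapsto> abel_map w t \<eta>\<close> stays outside the closed unit disc for these
  \<open>t\<close> and escapes to infinity.\<close>

lemma abel_ray_norm_ge:
  assumes "norm \<eta> = 1" "0 \<le> t"
  shows "t - \<bar>1 - t\<bar> * norm w \<le> norm (abel_map w t \<eta>)"
proof -
  have "norm (1 - complex_of_real t) = \<bar>1 - t\<bar>"
    by (metis norm_of_real of_real_1 of_real_diff)
  then show ?thesis
    using norm_triangle_ineq2[of "of_real t * \<eta>" "- abel_centre w t"] assms
    by (simp add: abel_map_alt norm_mult add.commute)
qed

text \<open>Runge approximation on the union \<open>X\<close> of the inner disc, the outer region
  \<open>Y\<close> near \<open>\<eta>0\<close>, and the circle \<open>C\<^sub>s\<close> without a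
  gap at \<open>\<eta>\<close>. Poles escape through the gap and then to infinity in the direction
  \<open>- \<eta>0\<close>, away from \<open>Y\<close>. The indicators of two discs, one slightly
  smaller and one slightly larger than that of \<open>C\<^sub>s\<close>, have a difference which is
  1 on the arc and 0 on the rest of \<open>X\<close>; multiplied by \<open>h\<close> it is the
  function to be approximated.\<close>

lemma abel_step:
  fixes w \<eta> \<eta>0 :: complex and a s b \<delta> \<epsilon> :: real
  assumes w: "norm w < 1" and asb: "0 < a" "a < s" "s < b"
    and \<eta>: "norm \<eta> = 1" and \<delta>: "\<delta> > 0" and \<eta>0: "norm \<eta>0 = 1" and \<epsilon>: "\<epsilon> > 0"
  defines "Y \<equiv> cball 0 1 \<inter> cball \<eta>0 ((1 - norm w) / 2) - ball (abel_centre w b) b"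
  shows "\<exists>p. (\<forall>z\<in>cball (abel_centre w a) a. norm (poly p z) < \<epsilon>) \<and>
             (\<forall>z\<in>Y. norm (poly p z) < \<epsilon>) \<and>
             (\<forall>\<zeta>\<in>sphere 0 1 - ball \<eta> \<delta>.
                norm (poly p (abel_map w s \<zeta>) - poly h (abel_map w s \<zeta>)) < \<epsilon>)"
proof -
  define A where "A = abel_map w s ` (sphere 0 1 - ball \<eta> \<delta>)"
  define X where "X = cball (abel_centre w a) a \<union> Y \<union> A"
  have cont: "continuous_on S (abel_map w t)" for S t
    unfolding abel_map_def by (intro continuous_intros)
  have "compact Y" unfolding Y_def by (intro compact_diff compact_Int) auto
  moreover have "compact A" unfolding A_def
    by (intro compact_continuous_image cont compact_diff) auto
  ultimately have X: "compact X" unfolding X_def by (intro compact_Un) auto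
  define T :: "complex set" where "T = sphere 0 1"
  \<comment> \<open>The circle with parameter \<open>s1\<close> separates the inner disc from the
    arc \<open>A\<close>, the one with parameter \<open>s2\<close> separates \<open>A\<close> from
    \<open>Y\<close>.\<close>
  define s1 s2 where "s1 = (a + s) / 2" and "s2 = (s + b) / 2"
  have s12: "a < s1" "s1 < s" "s < s2" "s2 < b" using asb by (auto simp: s1_def s2_def)
  \<comment> \<open>The escape route in coordinates \<open>(t, \<zeta>)\<close>: the annulus inside
    \<open>C\<^sub>s\<close>, a segment through the gap, the annulus outside
    \<open>C\<^sub>s\<close>, and a ray to infinity. Consecutive pieces overlap, so the union is
    connected.\<close>
  define G where "G = {a<..<s} \<times> T \<union> {a<..<b} \<times> {\<eta>} \<union> {s<..<b} \<times> T \<union> {s<..} \<times> {- \<eta>0}"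
  define N where "N = (\<lambda>(t, \<zeta>). abel_map w t \<zeta>) ` G"
  have connT: "connected T" unfolding T_def by (intro connected_sphere) auto
  have mem: "(s1, \<eta>) \<in> ({a<..<s} \<times> T) \<inter> ({a<..<b} \<times> {\<eta>})"
    "(s2, \<eta>) \<in> ({a<..<s} \<times> T \<union> {a<..<b} \<times> {\<eta>}) \<inter> ({s<..<b} \<times> T)"
    "(s2, - \<eta>0) \<in> ({a<..<s} \<times> T \<union> {a<..<b} \<times> {\<eta>} \<union> {s<..<b} \<times> T) \<inter> ({s<..} \<times> {- \<eta>0})"
    using s12 \<eta> \<eta>0 by (auto simp: T_def)
  have c: "connected ({a<..<s} \<times> T)" "connected ({a<..<b} \<times> {\<eta>})" "connected ({s<..<b} \<times> T)"
    "connected ({s<..} \<times> {- \<eta>0})"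
    by (intro connected_Times connT; simp)+
  have "connected ({a<..<s} \<times> T \<union> {a<..<b} \<times> {\<eta>})"
    by (rule connected_Un[OF c(1,2)]) (use mem(1) in blast)
  then have "connected ({a<..<s} \<times> T \<union> {a<..<b} \<times> {\<eta>} \<union> {s<..<b} \<times> T)"
    by (rule connected_Un[OF _ c(3)]) (use mem(2) in blast)
  then have "connected G" unfolding G_def
    by (rule connected_Un[OF _ c(4)]) (use mem(3) in blast)
  then have connN: "connected N" unfolding N_def abel_map_def case_prod_unfold
    by (intro connected_continuous_image continuous_intros)
  have Ndisj: "N \<inter> X = {}"
  proof -
    have "abel_map w t \<zeta> \<notin> X" if G: "(t, \<zeta>) \<in> G" for t \<zeta>
    proof -
      have t: "a < t" and \<zeta>: "norm \<zeta> = 1" and ts: "t \<noteq> s \<or> \<zeta> = \<eta>" and tb: "t < b \<or> \<zeta> = - \<eta>0"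
        using G asb \<eta> \<eta>0 by (auto simp: G_def T_def)
      have t0: "0 \<le> t" using t asb by simp
      note sph = abel_map_on_sphere[OF \<zeta> t0, of w]
      have "abel_map w t \<zeta> \<notin> cball (abel_centre w a) a"
        using abel_disc_nested[OF w t, of "abel_map w t \<zeta>"] sph by auto
      moreover have "abel_map w t \<zeta> \<notin> Y"
      proof (cases "t < b")
        case True
        then show ?thesis using abel_disc_nested[OF w True, of "abel_map w t \<zeta>"] sph
          by (auto simp: Y_def)
      next
        case False
        then have \<zeta>0: "\<zeta> = - \<eta>0" using tb by simp
        show ?thesis
        proof (cases "t \<le> 1")
          case True
          \<comment> \<open>Inside the unit disc the ray keeps distance at least
            \<open>1 - norm w\<close> from \<open>\<eta>0\<close>, twice the radius of the ball that
            defines \<open>Y\<close>.\<close>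
          have "abel_map w t \<zeta> - \<eta>0 = - (of_real (1 + t) * \<eta>0 - of_real (1 - t) * w)"
            by (simp add: abel_map_def \<zeta>0 algebra_simps)
          then have "norm (abel_map w t \<zeta> - \<eta>0) = norm (of_real (1 + t) * \<eta>0 - of_real (1 - t) * w)"
            by (simp only: norm_minus_cancel)
          moreover have "norm (of_real (1 + t) * \<eta>0) = 1 + t" "norm (of_real (1 - t) * w) = (1 - t) * norm w"
            unfolding norm_mult norm_of_real using \<eta>0 True t0 by auto
          ultimately have "1 + t - (1 - t) * norm w \<le> norm (abel_map w t \<zeta> - \<eta>0)"
            using norm_triangle_ineq2[of "of_real (1 + t) * \<eta>0" "of_real (1 - t) * w"] by simp
          moreover have "(1 - t) * norm w \<le> norm w" using t0 mult_right_mono[of "1 - t" 1 "norm w"] by simp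
          ultimately have "1 - norm w \<le> norm (abel_map w t \<zeta> - \<eta>0)"
            using t0 by linarith
          then have "norm (abel_map w t \<zeta> - \<eta>0) > (1 - norm w) / 2"
            using w by (simp add: field_simps)
          then show ?thesis by (auto simp: Y_def dist_norm norm_minus_commute)
        next
          case False
          then have "(t - 1) * norm w < t - 1" using w by simp
          moreover have "\<bar>1 - t\<bar> = t - 1" using False by simp
          then have "t - (t - 1) * norm w \<le> norm (abel_map w t \<zeta>)"
            using abel_ray_norm_ge[OF \<zeta> t0, of w] by metis
          ultimately have "1 < norm (abel_map w t \<zeta>)" by linarith
          then show ?thesis by (auto simp: Y_def)
        qed
      qed
      moreover have "abel_map w t \<zeta> \<notin> A"
      proof
        assume "abel_map w t \<zeta> \<in> A"
        then obtain \<zeta>' where \<zeta>': "norm \<zeta>' = 1" "\<zeta>' \<notin> ball \<eta> \<delta>" "abel_map w t \<zeta> = abel_map w s \<zeta>'"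
          by (auto simp: A_def)
        have sph': "abel_map w t \<zeta> \<in> sphere (abel_centre w s) s"
          unfolding \<zeta>'(3) using \<zeta>'(1) asb by (intro abel_map_on_sphere) auto
        have "\<not> t < s" using abel_disc_nested[OF w, of t s "abel_map w t \<zeta>"] sph sph' by auto
        moreover have "\<not> s < t" using abel_disc_nested[OF w, of s t "abel_map w t \<zeta>"] sph sph' by auto
        ultimately have "t = s" by simp
        then have "\<zeta> = \<eta>" "\<zeta> = \<zeta>'" using ts \<zeta>'(3) asb by (auto simp: abel_map_def)
        then show False using \<zeta>'(2) \<delta> by simp
      qed
      ultimately show ?thesis by (simp add: X_def)
    qed
    then show ?thesis by (auto simp: N_def)
  qed
  have "\<not> bounded N"
  proof
    assume "bounded N"
    then obtain B where B: "\<And>z. z \<in> N \<Longrightarrow> norm z \<le> B" by (meson bounded_iff)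
    \<comment> \<open>On the ray the modulus is at least
      \<open>t - (1 + t) * norm w = t * (1 - norm w) - norm w\<close>, which exceeds
      \<open>B\<close> for this \<open>t\<close>.\<close>
    define t where "t = max (s + 1) ((\<bar>B\<bar> + 2) / (1 - norm w))"
    have t: "s < t" "0 \<le> t" "(\<bar>B\<bar> + 2) / (1 - norm w) \<le> t"
      using asb by (auto simp: t_def)
    have "\<bar>B\<bar> + 2 \<le> t * (1 - norm w)" using t(3) w by (simp add: divide_le_eq)
    moreover have "\<bar>1 - t\<bar> * norm w \<le> (1 + t) * norm w" using t by (intro mult_right_mono) auto
    ultimately have "B < norm (abel_map w t (- \<eta>0))"
      using abel_ray_norm_ge[of "- \<eta>0" t w] \<eta>0 t(2) w by (simp add: algebra_simps)
    moreover have "(t, - \<eta>0) \<in> G" using t by (simp add: G_def)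
    then have "abel_map w t (- \<eta>0) \<in> N" unfolding N_def by force
    ultimately show False using B by force
  qed
  note pole = poly_approx_on_pole[OF X connN Ndisj this]
  have sphN: "sphere (abel_centre w u) u \<subseteq> N" if u: "u = s1 \<or> u = s2" for u
  proof
    fix z assume z: "z \<in> sphere (abel_centre w u) u"
    have "0 < u" using u s12 asb by auto
    then obtain \<zeta> where \<zeta>: "norm \<zeta> = 1" "z = abel_map w u \<zeta>" using abel_map_surj_sphere[OF z] by blast
    then have "(u, \<zeta>) \<in> G" using u s12 by (auto simp: G_def T_def)
    then show "z \<in> N" unfolding N_def \<zeta>(2) by force
  qed
  have ind: "poly_approx_on X (indicator (ball (abel_centre w u) u))" if u: "u = s1 \<or> u = s2" for u
  proof (rule poly_approx_on_indicator_ball[OF X])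
    show "0 < u" using u s12 asb by auto
    show "X \<inter> sphere (abel_centre w u) u = {}" using sphN[OF u] Ndisj by blast
    show "poly_approx_on X (\<lambda>z. 1 / (z - v))" if "v \<in> sphere (abel_centre w u) u" for v
      using pole sphN[OF u] that by blast
  qed
  define g where "g z = (indicator (ball (abel_centre w s2) s2) z
      - indicator (ball (abel_centre w s1) s1) z) * poly h z" for z
  have "poly_approx_on X g" unfolding g_def
    by (intro poly_approx_on_mult X poly_approx_on_diff ind poly_approx_on_poly) auto
  then obtain p where p: "\<And>z. z \<in> X \<Longrightarrow> norm (poly p z - g z) < \<epsilon>"
    using poly_approx_onD \<epsilon> by blast
  have "norm (poly p z) < \<epsilon>" if z: "z \<in> cball (abel_centre w a) a" for z
  proof -
    have "g z = 0" unfolding g_def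
      using abel_disc_nested[OF w _ z, of s1] abel_disc_nested[OF w _ z, of s2] s12
      by (simp add: indicator_def)
    then show ?thesis using p[of z] z by (simp add: X_def)
  qed
  moreover have "norm (poly p z) < \<epsilon>" if z: "z \<in> Y" for z
  proof -
    have nb: "z \<notin> ball (abel_centre w b) b" using z by (simp add: Y_def)
    have "z \<notin> ball (abel_centre w u) u" if "u < b" for u
      using abel_disc_nested[OF w that, of z] nb by auto
    then have "g z = 0" unfolding g_def using s12 by (simp add: indicator_def)
    then show ?thesis using p[of z] z by (simp add: X_def)
  qed
  moreover have "norm (poly p (abel_map w s \<zeta>) - poly h (abel_map w s \<zeta>)) < \<epsilon>"
    if \<zeta>: "\<zeta> \<in> sphere 0 1 - ball \<eta> \<delta>" for \<zeta>
  proof -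
    define z where "z = abel_map w s \<zeta>"
    have zA: "z \<in> A" using \<zeta> by (simp add: A_def z_def)
    have z: "z \<in> sphere (abel_centre w s) s"
      using \<zeta> asb unfolding z_def by (intro abel_map_on_sphere) auto
    have "z \<in> ball (abel_centre w s2) s2" using abel_disc_nested[OF w s12(3), of z] z by auto
    moreover have "z \<notin> ball (abel_centre w s1) s1"
      using abel_disc_nested[OF w s12(2), of z] z by auto
    ultimately have "g z = poly h z" unfolding g_def by (simp add: indicator_def)
    then show ?thesis using p[of z] zA by (simp add: X_def z_def)
  qed
  ultimately show ?thesis by blast
qed

text \<open>The increments from index \<open>k\<close> on are dominated by a geometric series with
  sum \<open>2 * (1/2) ^ k\<close>.\<close>

lemma lim_geometric_increments:
  fixes x :: "nat \<Rightarrow> complex"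
  assumes "\<And>j. k \<le> j \<Longrightarrow> norm (x (Suc j) - x j) \<le> (1/2) ^ j"
  shows "convergent x" and "norm (lim x - x k) \<le> 2 * (1/2) ^ k"
proof -
  \<comment> \<open>The exact partial sum of the series is kept so that the induction
    closes.\<close>
  have bound: "norm (x (m + n) - x m) \<le> 2 * (1/2) ^ m - 2 * (1/2) ^ (m + n)" if "k \<le> m" for m n
  proof (induction n)
    case (Suc n)
    have "norm (x (m + Suc n) - x m) \<le> norm (x (Suc (m + n)) - x (m + n)) + norm (x (m + n) - x m)"
      using norm_triangle_ineq[of "x (Suc (m + n)) - x (m + n)" "x (m + n) - x m"] by simp
    also have "\<dots> \<le> (1/2) ^ (m + n) + (2 * (1/2) ^ m - 2 * (1/2) ^ (m + n))"
      using that by (intro add_mono assms Suc.IH) auto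
    finally show ?case by simp
  qed simp
  have bound': "norm (x n - x m) \<le> 2 * (1/2) ^ m" if mn: "k \<le> m" "m \<le> n" for m n
  proof -
    have "norm (x n - x m) \<le> 2 * (1/2) ^ m - 2 * (1/2) ^ n"
      using bound[OF mn(1), of "n - m"] mn(2) by simp
    also have "\<dots> \<le> 2 * (1/2) ^ m" by simp
    finally show ?thesis .
  qed
  have "Cauchy x"
  proof (rule CauchyI')
    fix e :: real assume "e > 0"
    have "(\<lambda>n. 2 * (1/2 :: real) ^ n) \<longlonglongrightarrow> 2 * 0"
      by (intro tendsto_intros LIMSEQ_power_zero) auto
    then have "\<forall>\<^sub>F n in sequentially. 2 * (1/2) ^ n < e \<and> k \<le> n"
      using \<open>e > 0\<close> by (intro eventually_conj eventually_ge_at_top) (auto simp: order_tendsto_iff)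
    from eventually_happens'[OF sequentially_bot this]
    obtain M where M: "2 * (1/2) ^ M < e" "k \<le> M" by blast
    have "dist (x m) (x n) < e" if "M \<le> m" "m < n" for m n
    proof -
      have "norm (x n - x m) \<le> 2 * (1/2) ^ m" using that M by (intro bound') auto
      also have "\<dots> \<le> 2 * (1/2) ^ M" using that by (intro mult_left_mono power_decreasing) auto
      finally show ?thesis using M by (simp add: dist_norm norm_minus_commute)
    qed
    then show "\<exists>M. \<forall>m\<ge>M. \<forall>n>m. dist (x m) (x n) < e" by blast
  qed
  then show conv: "convergent x" by (simp add: Cauchy_convergent_iff)
  then have "x \<longlonglongrightarrow> lim x" by (simp add: convergent_LIMSEQ_iff)
  then have "(\<lambda>n. norm (x n - x k)) \<longlonglongrightarrow> norm (lim x - x k)" by (intro tendsto_intros)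
  then show "norm (lim x - x k) \<le> 2 * (1/2) ^ k"
    by (rule LIMSEQ_le_const2) (auto intro!: exI[of _ k] bound')
qed

section \<open>A countable family of approximation tasks\<close>

definition gaussian_rat :: "rat \<times> rat \<Rightarrow> complex" where
  "gaussian_rat = (\<lambda>(u, v). Complex (of_rat u) (of_rat v))"

lemma gaussian_rat_dense:
  assumes "\<epsilon> > 0" obtains q where "norm (gaussian_rat q - z) < \<epsilon>"
proof -
  obtain u v where u: "Re z < of_rat u" "of_rat u < Re z + \<epsilon>/2"
    and v: "Im z < of_rat v" "of_rat v < Im z + \<epsilon>/2"
    using of_rat_dense[of "Re z" "Re z + \<epsilon>/2"] of_rat_dense[of "Im z" "Im z + \<epsilon>/2"] assms by auto
  have "norm (gaussian_rat (u, v) - z) < \<epsilon>"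
    using cmod_le[of "gaussian_rat (u, v) - z"] u v by (simp add: gaussian_rat_def)
  then show ?thesis by (rule that)
qed

text \<open>Coefficients are rounded one at a time in Horner form; on the closed unit disc the
  multiplication by \<open>z\<close> does not enlarge the error made so far.\<close>

lemma gaussian_rat_poly_dense:
  assumes "\<epsilon> > 0"
  shows "\<exists>l. \<forall>z. norm z \<le> 1 \<longrightarrow> norm (poly (Poly (map gaussian_rat l)) z - poly p z) < \<epsilon>"
  using assms
proof (induction p arbitrary: \<epsilon>)
  case 0
  then show ?case by (intro exI[of _ "[]"]) simp
next
  case (pCons c p)
  obtain q where q: "norm (gaussian_rat q - c) < \<epsilon>/2"
    using gaussian_rat_dense[of "\<epsilon>/2"] pCons.prems by auto
  obtain l where l: "\<And>z. norm z \<le> 1 \<Longrightarrow> norm (poly (Poly (map gaussian_rat l)) z - poly p z) < \<epsilon>/2"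
    using pCons.IH[of "\<epsilon>/2"] pCons.prems by auto
  have "norm (poly (Poly (map gaussian_rat (q # l))) z - poly (pCons c p) z) < \<epsilon>" if z: "norm z \<le> 1" for z
  proof -
    have "poly (Poly (map gaussian_rat (q # l))) z - poly (pCons c p) z =
        (gaussian_rat q - c) + z * (poly (Poly (map gaussian_rat l)) z - poly p z)"
      by (simp add: algebra_simps)
    also have "norm \<dots> \<le> norm (gaussian_rat q - c) + norm z * norm (poly (Poly (map gaussian_rat l)) z - poly p z)"
      by (metis norm_mult norm_triangle_ineq)
    also have "norm z * norm (poly (Poly (map gaussian_rat l)) z - poly p z) \<le>
        1 * norm (poly (Poly (map gaussian_rat l)) z - poly p z)"
      using z by (intro mult_right_mono) auto
    also have "norm (gaussian_rat q - c) + 1 * norm (poly (Poly (map gaussian_rat l)) z - poly p z) < \<epsilon>"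
      using q l[OF z] by simp
    finally show ?thesis by simp
  qed
  then show ?case by blast
qed

lemma cis_rat_dense:
  assumes "norm \<eta> = 1" "\<epsilon> > 0"
  obtains q :: rat where "dist \<eta> (cis (of_rat q)) < \<epsilon>"
proof -
  define \<theta> where "\<theta> = Arg \<eta>"
  have \<eta>: "\<eta> = cis \<theta>"
    using rcis_cmod_Arg[of \<eta>] assms by (simp add: rcis_def \<theta>_def)
  have "isCont cis \<theta>"
    using continuous_on_cis[OF continuous_on_id, of UNIV] by (simp add: continuous_on_eq_continuous_at)
  then obtain d where d: "d > 0" "\<And>x. \<bar>x - \<theta>\<bar> < d \<Longrightarrow> dist (cis x) (cis \<theta>) < \<epsilon>"
    using assms(2) unfolding continuous_at_eps_delta dist_real_def by meson
  obtain q where "\<theta> < of_rat q" "of_rat q < \<theta> + d"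
    using of_rat_dense[of \<theta> "\<theta> + d"] d by auto
  then have "dist (cis (of_rat q)) (cis \<theta>) < \<epsilon>" by (intro d) simp
  then show ?thesis using that \<eta> by (simp add: dist_commute)
qed

text \<open>
  A task prescribes a polynomial with Gaussian rational coefficients to be approximated and the
  arc (by centre \<open>cis q\<close> and radius \<open>1 / Suc n\<close>) left out of the circle.
\<close>
definition task :: "nat \<Rightarrow> (rat \<times> rat) list \<times> rat \<times> nat" where
  "task k = from_nat (fst (prod_decode k))"

text \<open>The second component of the pair encoded by \<open>k\<close> is a free counter, so each
  task returns at arbitrarily late indices.\<close>

lemma task_recurs: "\<exists>k'>k. task k' = x"
proof -
  have "task (prod_encode (to_nat x, Suc k)) = x" by (simp add: task_def)
  moreover have "k < prod_encode (to_nat x, Suc k)"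
    using le_prod_encode_2[of "Suc k" "to_nat x"] by simp
  ultimately show ?thesis by blast
qed

definition task_poly :: "nat \<Rightarrow> complex poly" where
  "task_poly k = Poly (map gaussian_rat (fst (task k)))"

definition task_gap :: "nat \<Rightarrow> complex set" where
  "task_gap k = ball (cis (of_rat (fst (snd (task k))))) (1 / real (Suc (snd (snd (task k)))))"

text \<open>A point of the circle off \<open>K\<close> has a neighbourhood missing \<open>K\<close>,
  which contains a gap of the listed form. The polynomial comes from approximating on
  \<open>K\<close> and then rounding the coefficients; recurrence places the task after
  \<open>k\<close>.\<close>

lemma task_exists:
  assumes K: "compact K" "K \<subseteq> sphere 0 1" "K \<noteq> sphere 0 1" and \<phi>: "continuous_on K \<phi>" and e: "\<epsilon> > 0"
  shows "\<exists>k'>k. K \<inter> task_gap k' = {} \<and> (\<forall>\<zeta>\<in>K. norm (poly (task_poly k') \<zeta> - \<phi> \<zeta>) < \<epsilon>)"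
proof -
  obtain \<eta> where \<eta>: "norm \<eta> = 1" "\<eta> \<notin> K" using K(2,3) by fastforce
  have "open (- K)" using K(1) by (simp add: compact_imp_closed open_Compl)
  then obtain d where d: "d > 0" "ball \<eta> d \<subseteq> - K" using \<eta>(2) by (meson ComplI open_contains_ball)
  obtain n where n: "1 / real (Suc n) < d / 2" using d(1) reals_Archimedean[of "d/2"]
    by (auto simp: inverse_eq_divide)
  obtain q where q: "dist \<eta> (cis (of_rat q)) < d / 2" using cis_rat_dense[OF \<eta>(1), of "d/2"] d by auto
  have gap: "ball (cis (of_rat q)) (1 / real (Suc n)) \<subseteq> ball \<eta> d"
  proof
    fix y assume "y \<in> ball (cis (of_rat q)) (1 / real (Suc n))"
    then have "dist (cis (of_rat q)) y < d / 2" using n by simp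
    then show "y \<in> ball \<eta> d" using q dist_triangle[of \<eta> y "cis (of_rat q)"] by simp
  qed
  obtain p where p: "\<And>\<zeta>. \<zeta> \<in> K \<Longrightarrow> norm (poly p \<zeta> - \<phi> \<zeta>) < \<epsilon>/2"
    using poly_approx_onD[OF poly_approx_on_circle_subset[OF K \<phi>], of "\<epsilon>/2"] e by auto
  obtain l where l: "\<And>z. norm z \<le> 1 \<Longrightarrow> norm (poly (Poly (map gaussian_rat l)) z - poly p z) < \<epsilon>/2"
    using gaussian_rat_poly_dense[of "\<epsilon>/2" p] e by auto
  obtain k' where k': "k' > k" "task k' = (l, q, n)" using task_recurs by blast
  have "norm (poly (task_poly k') \<zeta> - \<phi> \<zeta>) < \<epsilon>" if \<zeta>: "\<zeta> \<in> K" for \<zeta>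
  proof -
    have "norm \<zeta> \<le> 1" using \<zeta> K(2) by auto
    then show ?thesis
      using norm_diff_triangle_less[OF l p[OF \<zeta>]] by (simp add: task_poly_def k')
  qed
  moreover have "K \<inter> task_gap k' = {}" using gap d(2) by (simp add: task_gap_def k') blast
  ultimately show ?thesis using k'(1) by blast
qed

text \<open>The function is the limit of polynomials \<open>S k\<close>. The increment at stage
  \<open>k\<close> is small on the disc of parameter \<open>a k\<close>, which gives convergence,
  and small on \<open>Y k\<close>, which gives the bound; on \<open>C\<^sub>t\<close> with
  \<open>t = r (m k)\<close>, off the gap, it makes the next polynomial match task \<open>k\<close>.
  Since this circle lies in the disc of parameter \<open>a (Suc k)\<close>, later increments hardly
  disturb the match.\<close>

lemma universal_bounded_between_shells:
  fixes r a b :: "nat \<Rightarrow> real" and m :: "nat \<Rightarrow> nat" and w \<eta>0 :: complex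
  assumes r: "abel_radii r" and w: "norm w < 1" and \<eta>0: "norm \<eta>0 = 1" and m: "strict_mono m"
    and ab: "\<And>k. 0 < a k" "\<And>k. a k < r (m k)" "\<And>k. r (m k) < b k" "\<And>k. b k < a (Suc k)"
  obtains f where "f \<in> abel_universal_wrt w r"
    and "\<And>z. z \<in> ball 0 1 \<inter> cball \<eta>0 ((1 - norm w) / 2) \<Longrightarrow>
      (\<And>k. z \<notin> ball (abel_centre w (b k)) (b k) - cball (abel_centre w (a k)) (a k)) \<Longrightarrow> norm (f z) \<le> 2"
proof -
  define s where "s k = r (m k)" for k
  have asb: "0 < a k" "a k < s k" "s k < b k" "b k < a (Suc k)" for k using ab by (auto simp: s_def)
  have s1: "s k < 1" for k using r by (simp add: s_def abel_radii_def)
  have a1: "a k < 1" for k using asb(2)[of k] s1[of k] by simp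
  have "s \<longlonglongrightarrow> 1" unfolding s_def
    using r LIMSEQ_subseq_LIMSEQ[OF _ m, of r 1] by (simp add: abel_radii_def comp_def)
  then have "(\<lambda>k. a (Suc k)) \<longlonglongrightarrow> 1"
    by (rule tendsto_sandwich[rotated 2, OF _ tendsto_const])
      (use asb(3,4) a1 in \<open>auto intro!: always_eventually less_imp_le intro: less_trans\<close>)
  then have a_lim: "a \<longlonglongrightarrow> 1" by (simp add: filterlim_sequentially_Suc)
  have a_mono: "strict_mono a"
    unfolding strict_mono_Suc_iff using asb by (meson less_trans)
  have a_le: "z \<in> cball (abel_centre w (a j)) (a j)"
    if "z \<in> cball (abel_centre w (a k)) (a k)" "k \<le> j" for z j k
    using abel_disc_nested[OF w strict_monoD[OF a_mono], of k j z] that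
    by (cases "k = j") auto
  define Y where "Y k = cball 0 1 \<inter> cball \<eta>0 ((1 - norm w) / 2) - ball (abel_centre w (b k)) (b k)" for k
  \<comment> \<open>The implication for \<open>k = 0\<close> fixes the start of the recursion; the
    other conditions relate consecutive polynomials.\<close>
  have "\<exists>S. \<forall>k. (k = 0 \<longrightarrow> S k = 0) \<and>
      ((\<forall>z\<in>cball (abel_centre w (a k)) (a k). norm (poly (S (Suc k)) z - poly (S k) z) < (1/2) ^ k) \<and>
       (\<forall>z\<in>Y k. norm (poly (S (Suc k)) z - poly (S k) z) < (1/2) ^ k) \<and>
       (\<forall>\<zeta>\<in>sphere 0 1 - task_gap k.
          norm (poly (S (Suc k)) (abel_map w (s k) \<zeta>) - poly (task_poly k) \<zeta>) < (1/2) ^ k))"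
  proof (rule dependent_nat_choice)
    fix S :: "complex poly" and k :: nat
    \<comment> \<open>The inner linear polynomial inverts \<open>abel_map w (s k)\<close>, so the
      task is transplanted to the circle; what \<open>S\<close> already contributes there is
      subtracted.\<close>
    define h where "h = pcompose (task_poly k) [:w - w / of_real (s k), 1 / of_real (s k):] - S"
    have "s k \<noteq> 0" using asb(1,2)[of k] by simp
    then have h: "poly h (abel_map w (s k) \<zeta>) = poly (task_poly k) \<zeta> - poly S (abel_map w (s k) \<zeta>)" for \<zeta>
    proof -
      have "w - w / of_real (s k) + abel_map w (s k) \<zeta> * (1 / of_real (s k)) = \<zeta>"
        using \<open>s k \<noteq> 0\<close> by (simp add: abel_map_def field_simps)
      then show ?thesis by (simp add: h_def poly_pcompose)
    qed
    have "\<exists>p. (\<forall>z\<in>cball (abel_centre w (a k)) (a k). norm (poly p z) < (1/2) ^ k) \<and>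
             (\<forall>z\<in>Y k. norm (poly p z) < (1/2) ^ k) \<and>
             (\<forall>\<zeta>\<in>sphere 0 1 - task_gap k.
                norm (poly p (abel_map w (s k) \<zeta>) - poly h (abel_map w (s k) \<zeta>)) < (1/2) ^ k)"
      unfolding Y_def task_gap_def by (rule abel_step[OF w asb(1-3)]) (auto simp: \<eta>0)
    then obtain p where p: "\<forall>z\<in>cball (abel_centre w (a k)) (a k). norm (poly p z) < (1/2) ^ k"
      "\<forall>z\<in>Y k. norm (poly p z) < (1/2) ^ k"
      "\<forall>\<zeta>\<in>sphere 0 1 - task_gap k.
          norm (poly p (abel_map w (s k) \<zeta>) - poly h (abel_map w (s k) \<zeta>)) < (1/2) ^ k"
      by blast
    have diff: "poly (S + p) (abel_map w (s k) \<zeta>) - poly (task_poly k) \<zeta> =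
        poly p (abel_map w (s k) \<zeta>) - poly h (abel_map w (s k) \<zeta>)" for \<zeta>
      by (simp add: h)
    then show "\<exists>y. (Suc k = 0 \<longrightarrow> y = 0) \<and>
      ((\<forall>z\<in>cball (abel_centre w (a k)) (a k). norm (poly y z - poly S z) < (1/2) ^ k) \<and>
       (\<forall>z\<in>Y k. norm (poly y z - poly S z) < (1/2) ^ k) \<and>
       (\<forall>\<zeta>\<in>sphere 0 1 - task_gap k.
          norm (poly y (abel_map w (s k) \<zeta>) - poly (task_poly k) \<zeta>) < (1/2) ^ k))"
      using p(1,2)
    proof (intro exI[of _ "S + p"] conjI)
      show "\<forall>\<zeta>\<in>sphere 0 1 - task_gap k.
          norm (poly (S + p) (abel_map w (s k) \<zeta>) - poly (task_poly k) \<zeta>) < (1/2) ^ k"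
        unfolding diff by (rule p(3))
    qed simp_all
  qed auto
  then obtain S where S0: "S 0 = 0"
    and S1: "\<And>k z. z \<in> cball (abel_centre w (a k)) (a k) \<Longrightarrow> norm (poly (S (Suc k)) z - poly (S k) z) < (1/2) ^ k"
    and S2: "\<And>k z. z \<in> Y k \<Longrightarrow> norm (poly (S (Suc k)) z - poly (S k) z) < (1/2) ^ k"
    and S3: "\<And>k \<zeta>. norm \<zeta> = 1 \<Longrightarrow> \<zeta> \<notin> task_gap k \<Longrightarrow>
       norm (poly (S (Suc k)) (abel_map w (s k) \<zeta>) - poly (task_poly k) \<zeta>) < (1/2) ^ k"
    by (metis DiffI mem_sphere_0)
  define f where "f z = lim (\<lambda>n. poly (S n) z)" for z
  have f_close: "norm (f z - poly (S k) z) \<le> 2 * (1/2) ^ k"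
    if "z \<in> cball (abel_centre w (a k)) (a k)" for z k
    unfolding f_def
    by (rule lim_geometric_increments(2)) (use S1 a_le[OF that] less_imp_le in blast)
  have hol: "f holomorphic_on ball 0 1"
  proof (rule holomorphic_uniform_sequence[of _ "\<lambda>n. poly (S n)"])
    fix x :: complex assume x: "x \<in> ball 0 1"
    define d where "d = (1 - norm x) / 2"
    have d: "d > 0" "norm x + d < 1" using x by (auto simp: d_def field_simps)
    \<comment> \<open>The disc of parameter \<open>a k\<close> contains the disc around 0 of radius
      \<open>a k - (1 - a k) * norm w\<close>. As these radii tend to 1, the discs exhaust the unit
      disc.\<close>
    have "(\<lambda>k. a k - (1 - a k) * norm w) \<longlonglongrightarrow> 1 - (1 - 1) * norm w"
      by (intro tendsto_intros a_lim)
    then have "\<forall>\<^sub>F k in sequentially. norm x + d < a k - (1 - a k) * norm w"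
      using d by (simp add: order_tendsto_iff)
    from eventually_happens'[OF sequentially_bot this]
    obtain k where k: "norm x + d < a k - (1 - a k) * norm w" by blast
    have sub: "cball x d \<subseteq> cball (abel_centre w (a k)) (a k)"
    proof
      fix z assume z: "z \<in> cball x d"
      have "norm z \<le> norm x + d"
        using z norm_triangle_ineq2[of z x] by (simp add: dist_norm norm_minus_commute)
      moreover have "norm (1 - complex_of_real (a k)) = 1 - a k"
        using a1[of k] by (metis abs_of_pos diff_gt_0_iff_gt norm_of_real of_real_1 of_real_diff)
      then have "norm (abel_centre w (a k)) = (1 - a k) * norm w" by (simp add: norm_mult)
      ultimately show "z \<in> cball (abel_centre w (a k)) (a k)"
        using k norm_triangle_ineq4[of "abel_centre w (a k)" z] by (simp add: dist_norm)
    qed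
    have "uniform_limit (cball x d) (\<lambda>n. poly (S n)) f sequentially"
      unfolding uniform_limit_iff
    proof (intro allI impI)
      fix e :: real assume "e > 0"
      have "(\<lambda>n. 2 * (1/2 :: real) ^ n) \<longlonglongrightarrow> 2 * 0"
        by (intro tendsto_intros LIMSEQ_power_zero) auto
      then have "\<forall>\<^sub>F n in sequentially. 2 * (1/2) ^ n < e \<and> k \<le> n"
        using \<open>e > 0\<close> by (intro eventually_conj eventually_ge_at_top) (auto simp: order_tendsto_iff)
      then show "\<forall>\<^sub>F n in sequentially. \<forall>z\<in>cball x d. dist (poly (S n) z) (f z) < e"
      proof eventually_elim
        case (elim n)
        show ?case
        proof
          fix z assume "z \<in> cball x d"
          then have "norm (f z - poly (S n) z) \<le> 2 * (1/2) ^ n"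
            using sub a_le elim by (intro f_close) blast
          then show "dist (poly (S n) z) (f z) < e"
            using elim by (simp add: dist_norm norm_minus_commute)
        qed
      qed
    qed
    moreover have "cball x d \<subseteq> ball 0 1"
    proof
      fix z assume "z \<in> cball x d"
      then show "z \<in> ball 0 1"
        using d(2) norm_triangle_ineq2[of z x] by (simp add: dist_norm norm_minus_commute)
    qed
    ultimately show "\<exists>d>0. cball x d \<subseteq> ball 0 1 \<and> uniform_limit (cball x d) (\<lambda>n. poly (S n)) f sequentially"
      using d(1) by blast
  qed (auto intro!: holomorphic_intros)
  have univ: "\<exists>n::nat \<Rightarrow> nat. strict_mono n \<and>
      uniform_limit K (\<lambda>j \<zeta>. f (w + of_real (r (n j)) * (\<zeta> - w))) \<phi> sequentially"
    if K: "compact K" "K \<subseteq> sphere 0 1" "K \<noteq> sphere 0 1" and \<phi>: "continuous_on K \<phi>" for K \<phi>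
  proof -
    define P where "P j k \<longleftrightarrow> K \<inter> task_gap k = {} \<and>
        (\<forall>\<zeta>\<in>K. norm (poly (task_poly k) \<zeta> - \<phi> \<zeta>) < (1/2) ^ j)" for j k
    have ex: "\<exists>k'>k. P j k'" for j k
      unfolding P_def by (rule task_exists[OF K \<phi>]) simp
    have "\<exists>g. \<forall>j. P j (g j) \<and> g j < g (Suc j)"
      by (rule dependent_nat_choice) (use ex in blast)+
    then obtain g where g: "\<And>j. P j (g j)" "\<And>j. g j < g (Suc j)" by blast
    have gm: "strict_mono g" using g(2) by (simp add: strict_mono_Suc_iff)
    \<comment> \<open>Three errors add up: the tail of the increments after stage \<open>k\<close>,
      the matching error at stage \<open>k\<close>, and the distance of the task polynomial from
      \<open>\<phi>\<close>.\<close>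
    have est: "norm (f (abel_map w (s (g j)) \<zeta>) - \<phi> \<zeta>) \<le> 3 * (1/2) ^ j" if \<zeta>: "\<zeta> \<in> K" for j \<zeta>
    proof -
      define k where "k = g j"
      define z where "z = abel_map w (s k) \<zeta>"
      have n1: "norm \<zeta> = 1" using \<zeta> K(2) by auto
      have "j \<le> k" unfolding k_def by (rule seq_suble[OF gm])
      then have jk: "(1/2 :: real) ^ k \<le> (1/2) ^ j" by (intro power_decreasing) auto
      have "z \<in> sphere (abel_centre w (s k)) (s k)"
        unfolding z_def using asb(1,2)[of k] by (intro abel_map_on_sphere n1) simp
      moreover have "s k < a (Suc k)" using asb(3,4)[of k] by simp
      ultimately have "z \<in> cball (abel_centre w (a (Suc k))) (a (Suc k))"
        using abel_disc_nested[OF w, of "s k" "a (Suc k)" z] by (simp add: less_imp_le)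
      then have "norm (f z - poly (S (Suc k)) z) \<le> (1/2) ^ k"
        using f_close[of z "Suc k"] by simp
      moreover have "norm (poly (S (Suc k)) z - poly (task_poly k) \<zeta>) < (1/2) ^ k"
        unfolding z_def using \<zeta> g(1)[of j] by (intro S3 n1) (auto simp: P_def k_def)
      moreover have "norm (poly (task_poly k) \<zeta> - \<phi> \<zeta>) < (1/2) ^ j"
        using \<zeta> g(1)[of j] by (simp add: P_def k_def)
      moreover have "norm (f z - \<phi> \<zeta>) \<le> norm (f z - poly (S (Suc k)) z)
          + norm (poly (S (Suc k)) z - poly (task_poly k) \<zeta>) + norm (poly (task_poly k) \<zeta> - \<phi> \<zeta>)"
        using norm_triangle_ineq[of "f z - poly (S (Suc k)) z" "poly (S (Suc k)) z - poly (task_poly k) \<zeta>"]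
          norm_triangle_ineq[of "f z - poly (task_poly k) \<zeta>" "poly (task_poly k) \<zeta> - \<phi> \<zeta>"] by simp
      ultimately show ?thesis using jk unfolding z_def k_def by linarith
    qed
    have "uniform_limit K (\<lambda>j \<zeta>. f (abel_map w (r ((m \<circ> g) j)) \<zeta>)) \<phi> sequentially"
      unfolding uniform_limit_iff
    proof (intro allI impI)
      fix e :: real assume "e > 0"
      have "(\<lambda>n. 3 * (1/2 :: real) ^ n) \<longlonglongrightarrow> 3 * 0"
        by (intro tendsto_intros LIMSEQ_power_zero) auto
      then have "\<forall>\<^sub>F n in sequentially. 3 * (1/2) ^ n < e"
        using \<open>e > 0\<close> by (auto simp: order_tendsto_iff)
      then show "\<forall>\<^sub>F j in sequentially. \<forall>\<zeta>\<in>K. dist (f (abel_map w (r ((m \<circ> g) j)) \<zeta>)) (\<phi> \<zeta>) < e"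
      proof eventually_elim
        case (elim j)
        then show ?case using est[of _ j] by (force simp: dist_norm s_def)
      qed
    qed
    moreover have "strict_mono (m \<circ> g)" using m gm by (rule strict_mono_o)
    ultimately show ?thesis unfolding abel_map_def by blast
  qed
  have "f \<in> abel_universal_wrt w r" unfolding abel_universal_wrt_def using hol univ by blast
  moreover have "norm (f z) \<le> 2"
    if z: "z \<in> ball 0 1 \<inter> cball \<eta>0 ((1 - norm w) / 2)"
      "\<And>k. z \<notin> ball (abel_centre w (b k)) (b k) - cball (abel_centre w (a k)) (a k)" for z
  proof -
    \<comment> \<open>For each \<open>k\<close> a point outside the shell lies in the inner disc or
      in \<open>Y k\<close>. Either way the increment is small, and as \<open>S 0 = 0\<close> the
      increments sum to at most 2.\<close>
    have "norm (poly (S (Suc k)) z - poly (S k) z) \<le> (1/2) ^ k" for k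
    proof (cases "z \<in> cball (abel_centre w (a k)) (a k)")
      case True
      then show ?thesis using S1 less_imp_le by blast
    next
      case False
      then have "z \<in> Y k" using z by (auto simp: Y_def)
      then show ?thesis using S2 less_imp_le by blast
    qed
    then show ?thesis
      using lim_geometric_increments(2)[of 0 "\<lambda>n. poly (S n) z"] by (simp add: f_def S0)
  qed
  ultimately show ?thesis by (rule that)
qed

section \<open>Holomorphic maps between circles of two pencils\<close>

text \<open>The function \<open>h\<close> multiplies \<open>B z\<close> by the conjugate of
  \<open>B\<close> at the point reflected in the circle of radius \<open>\<rho>\<close>. On
  \<open>E\<close> both points coincide, so \<open>h\<close> is \<open>\<sigma>\<^sup>2\<close>
  there and, by the identity theorem, on the whole annulus. At the unit circle the first factor has
  modulus 1, which leaves the modulus of \<open>B\<close> on the circle of radius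
  \<open>\<rho>\<^sup>2\<close>.\<close>

lemma norm_reflect_circle:
  fixes B :: "complex \<Rightarrow> complex"
  assumes cont: "continuous_on (cball 0 1) B" and hol: "B holomorphic_on ball 0 1"
    and bd: "\<And>z. norm z = 1 \<Longrightarrow> norm (B z) = 1"
    and \<rho>: "0 < \<rho>" "\<rho> < 1"
    and E: "infinite E" "E \<subseteq> sphere 0 \<rho>" "\<And>z. z \<in> E \<Longrightarrow> norm (B z) = \<sigma>"
    and z: "norm z = \<rho>\<^sup>2"
  shows "norm (B z) = \<sigma>\<^sup>2"
proof -
  define A :: "complex set" where "A = {z. \<rho>\<^sup>2 < norm z \<and> norm z < 1}"
  define h where "h z = B z * (cnj \<circ> B \<circ> cnj) (of_real (\<rho>\<^sup>2) / z)" for z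
  have \<rho>2: "0 < \<rho>\<^sup>2" "\<rho>\<^sup>2 < \<rho>" using \<rho> by (auto simp: power2_eq_square)
  have conj: "(cnj \<circ> B \<circ> cnj) holomorphic_on ball 0 1"
  proof (rule holomorphic_on_compose_cnj_cnj)
    have "cnj ` ball 0 1 = ball 0 1" unfolding image_cnj_conv_vimage_cnj by auto
    then show "B holomorphic_on cnj ` ball 0 1" using hol by simp
  qed simp
  have hol_h: "h holomorphic_on A"
  proof -
    have "((cnj \<circ> B \<circ> cnj) \<circ> (\<lambda>z. of_real (\<rho>\<^sup>2) / z)) holomorphic_on A"
    proof (rule holomorphic_on_compose_gen[OF _ conj])
      show "(\<lambda>z. of_real (\<rho>\<^sup>2) / z) holomorphic_on A"
        using \<rho>2 by (intro holomorphic_intros) (auto simp: A_def)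
      show "(\<lambda>z. of_real (\<rho>\<^sup>2) / z) ` A \<subseteq> ball 0 1"
      proof (clarsimp simp: norm_divide norm_power A_def)
        fix z :: complex assume "\<rho>\<^sup>2 < norm z"
        then show "\<rho>\<^sup>2 / norm z < 1" using \<rho>2 by (simp add: divide_less_eq)
      qed
    qed
    moreover have "B holomorphic_on A"
      using hol by (rule holomorphic_on_subset) (auto simp: A_def)
    ultimately show ?thesis
      unfolding h_def comp_def by (rule holomorphic_on_mult[rotated])
  qed
  have "compact (sphere (0::complex) \<rho>)" by simp
  then obtain \<xi> where \<xi>: "\<xi> \<in> sphere 0 \<rho>" "\<xi> islimpt E"
    using Heine_Borel_imp_Bolzano_Weierstrass E(1,2) by metis
  have EA: "sphere 0 \<rho> \<subseteq> A" using \<rho> \<rho>2 by (auto simp: A_def)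
  have hA: "h u = of_real (\<sigma>\<^sup>2)" if u: "u \<in> A" for u
  proof -
    have "h u - of_real (\<sigma>\<^sup>2) = 0"
    proof (rule analytic_continuation[where f = "\<lambda>u. h u - of_real (\<sigma>\<^sup>2)" and S = A and U = E and \<xi> = \<xi>])
      have "open (norm -` {\<rho>\<^sup>2<..<1} :: complex set)"
        by (rule open_vimage) (auto intro: continuous_intros)
      then show "open A" by (simp add: A_def vimage_def)
      show "connected A"
        using connected_annulus(1)[of "\<rho>\<^sup>2" "0::complex" 1] by (simp add: A_def)
      show "h e - of_real (\<sigma>\<^sup>2) = 0" if "e \<in> E" for e
      proof -
        have n: "norm e = \<rho>" using that E(2) by auto
        have "cnj e * e = of_real (\<rho>\<^sup>2)" using complex_norm_square[of e] n by (simp add: mult.commute)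
        moreover have "e \<noteq> 0" using n \<rho> by auto
        ultimately have "of_real (\<rho>\<^sup>2) / e = cnj e" by (simp add: field_simps)
        then have "h e = B e * cnj (B e)" by (simp add: h_def)
        also have "\<dots> = of_real (\<sigma>\<^sup>2)" using E(3)[OF that] complex_norm_square[of "B e"] by simp
        finally show ?thesis by simp
      qed
    qed (use E(2) EA \<xi> u in \<open>auto intro!: holomorphic_intros hol_h\<close>)
    then show ?thesis by simp
  qed
  have z0: "z \<noteq> 0" using z \<rho>2 by auto
  define y where "y = cnj (of_real (\<rho>\<^sup>2) / z)"
  have y: "norm y = 1" using z \<rho> by (simp add: y_def norm_divide norm_power)
  \<comment> \<open>This is \<open>h\<close> along the radius towards \<open>y\<close>, the
    reflection of \<open>z\<close>; it stays continuous up to \<open>t = 1\<close>, where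
    \<open>h\<close> itself is not known to be constant.\<close>
  define g where "g t = B (of_real t * y) * cnj (B (z / of_real t))" for t
  have "g 1 = of_real (\<sigma>\<^sup>2)"
  proof (rule continuous_constant_on_closure[where S = "{\<rho>\<^sup>2<..<1}"])
    have "closure {\<rho>\<^sup>2<..<1} = {\<rho>\<^sup>2..1}" using \<rho> \<rho>2 by simp
    then show "(1::real) \<in> closure {\<rho>\<^sup>2<..<1}" using \<rho> \<rho>2 by simp
    have "continuous_on {\<rho>\<^sup>2..1} g" unfolding g_def
    proof (intro continuous_intros)
      have "\<bar>t\<bar> \<le> 1" if "\<rho>\<^sup>2 \<le> t" "t \<le> 1" for t
        using that \<rho>2 by linarith
      then show "continuous_on {\<rho>\<^sup>2..1} (\<lambda>t. B (of_real t * y))"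
        by (intro continuous_on_compose2[OF cont])
          (auto intro!: continuous_intros simp: norm_mult y)
      have nz: "norm (z / complex_of_real t) \<le> 1" if "\<rho>\<^sup>2 \<le> t" for t
      proof -
        have "\<bar>t\<bar> = t" "0 < t" using that \<rho>2 by linarith+
        then show ?thesis using that by (simp add: norm_divide z)
      qed
      show "continuous_on {\<rho>\<^sup>2..1} (\<lambda>t. B (z / of_real t))"
        by (rule continuous_on_compose2[OF cont])
          (use \<rho> nz in \<open>auto intro!: continuous_intros simp: norm_divide\<close>)
    qed
    then show "continuous_on (closure {\<rho>\<^sup>2<..<1}) g"
      using \<open>closure {\<rho>\<^sup>2<..<1} = {\<rho>\<^sup>2..1}\<close> by simp
    show "g t = of_real (\<sigma>\<^sup>2)" if "t \<in> {\<rho>\<^sup>2<..<1}" for t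
    proof -
      have t: "0 < t" using that \<rho>2 by (meson greaterThanLessThan_iff less_trans)
      have "of_real t * y \<in> A" using that t by (simp add: A_def norm_mult y)
      then have "h (of_real t * y) = of_real (\<sigma>\<^sup>2)" by (rule hA)
      moreover have "cnj (of_real (\<rho>\<^sup>2) / (of_real t * y)) = z / of_real t"
        using z0 \<rho> t by (simp add: y_def)
      ultimately show ?thesis by (simp add: h_def g_def)
    qed
  qed
  then have "norm (g 1) = \<sigma>\<^sup>2" by (simp add: norm_power)
  moreover have "norm (g 1) = norm (B y) * norm (B z)" by (simp add: g_def norm_mult)
  ultimately show ?thesis using bd[OF y] by simp
qed

lemma infinite_sphere_complex:
  assumes "\<rho> > 0" shows "infinite (sphere (0::complex) \<rho>)"
proof -
  have "inj_on (\<lambda>t. Complex t (sqrt (\<rho>\<^sup>2 - t\<^sup>2))) {0..\<rho>}" by (auto simp: inj_on_def)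
  moreover have "(\<lambda>t. Complex t (sqrt (\<rho>\<^sup>2 - t\<^sup>2))) ` {0..\<rho>} \<subseteq> sphere 0 \<rho>"
    using assms by (auto simp: cmod_def power_mono)
  moreover have "infinite {0..\<rho>}" using assms by simp
  ultimately show ?thesis using finite_subset finite_image_iff by metis
qed

text \<open>One reflection turns the infinite set \<open>E\<close> into a full circle, to which the
  reflection applies again; both radii are squared each time.\<close>

lemma norm_reflect_circle_iter:
  fixes B :: "complex \<Rightarrow> complex"
  assumes cont: "continuous_on (cball 0 1) B" and hol: "B holomorphic_on ball 0 1"
    and bd: "\<And>z. norm z = 1 \<Longrightarrow> norm (B z) = 1"
    and \<rho>: "0 < \<rho>" "\<rho> < 1"
    and E: "infinite E" "E \<subseteq> sphere 0 \<rho>" "\<And>z. z \<in> E \<Longrightarrow> norm (B z) = \<sigma>"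
  shows "norm z = \<rho> ^ 2 ^ Suc k \<Longrightarrow> norm (B z) = \<sigma> ^ 2 ^ Suc k"
proof (induction k arbitrary: z)
  case 0
  then show ?case using norm_reflect_circle[OF assms, of z] by simp
next
  case (Suc k)
  have "norm (B z) = (\<sigma> ^ 2 ^ Suc k)\<^sup>2"
  proof (rule norm_reflect_circle[OF cont hol bd])
    show "0 < \<rho> ^ 2 ^ Suc k" "\<rho> ^ 2 ^ Suc k < 1" using \<rho> by (auto simp: power_less_one_iff)
    then show "infinite (sphere (0::complex) (\<rho> ^ 2 ^ Suc k))" by (intro infinite_sphere_complex)
    show "norm (B x) = \<sigma> ^ 2 ^ Suc k" if "x \<in> sphere 0 (\<rho> ^ 2 ^ Suc k)" for x
      using that by (intro Suc.IH) simp
    show "norm z = (\<rho> ^ 2 ^ Suc k)\<^sup>2"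
      using Suc.prems by (simp add: power_mult[symmetric] mult.commute)
  qed auto
  then show ?case by (simp add: power_mult[symmetric] mult.commute)
qed

text \<open>Along points of modulus \<open>\<rho> ^ 2 ^ Suc k\<close> the values of \<open>B\<close>
  have modulus \<open>\<sigma> ^ 2 ^ Suc k\<close>; both tend to 0, hence \<open>B 0 = 0\<close>.
  The Schwarz lemma gives \<open>\<sigma> \<le> \<rho>\<close>. If the inequality is strict, the
  difference quotients at 0 have modulus \<open>(\<sigma> / \<rho>) ^ 2 ^ Suc k\<close> and tend to
  0.\<close>

lemma circle_to_circle_at_0:
  fixes B :: "complex \<Rightarrow> complex"
  assumes cont: "continuous_on (cball 0 1) B" and hol: "B holomorphic_on ball 0 1"
    and bd: "\<And>z. norm z = 1 \<Longrightarrow> norm (B z) = 1"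
    and lt1: "\<And>z. norm z < 1 \<Longrightarrow> norm (B z) < 1"
    and \<rho>: "0 < \<rho>" "\<rho> < 1" and \<sigma>: "0 \<le> \<sigma>" "\<sigma> < 1"
    and E: "infinite E" "E \<subseteq> sphere 0 \<rho>" "\<And>z. z \<in> E \<Longrightarrow> norm (B z) = \<sigma>"
  shows "B 0 = 0" and "\<sigma> = \<rho> \<or> deriv B 0 = 0"
proof -
  note it = norm_reflect_circle_iter[OF cont hol bd \<rho> E]
  define y where "y k = complex_of_real (\<rho> ^ 2 ^ Suc k)" for k
  have ny: "norm (y k) = \<rho> ^ 2 ^ Suc k" for k using \<rho> by (simp add: y_def norm_power)
  have By: "norm (B (y k)) = \<sigma> ^ 2 ^ Suc k" for k by (rule it) (auto simp: ny)
  have sm: "strict_mono (\<lambda>k::nat. 2 ^ Suc k :: nat)" by (auto simp: strict_mono_Suc_iff)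
  have pw: "(\<lambda>k. c ^ 2 ^ Suc k) \<longlonglongrightarrow> 0" if "0 \<le> c" "c < 1" for c :: real
    using LIMSEQ_subseq_LIMSEQ[OF LIMSEQ_power_zero sm, of c] that by (simp add: comp_def)
  have y0: "y \<longlonglongrightarrow> 0"
    using pw[of \<rho>] \<rho> by (simp add: tendsto_norm_zero_iff[of y, symmetric] ny)
  have der: "(B has_field_derivative deriv B 0) (at 0)"
    using hol by (intro holomorphic_derivI) auto
  have "(\<lambda>k. B (y k)) \<longlonglongrightarrow> B 0"
    using DERIV_isCont[OF der] y0 by (rule isCont_tendsto_compose)
  moreover have "(\<lambda>k. B (y k)) \<longlonglongrightarrow> 0"
    using pw[OF \<sigma>] By by (subst tendsto_norm_zero_iff[symmetric]) simp
  ultimately show B0: "B 0 = 0" by (rule LIMSEQ_unique)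
  have ne: "y k \<noteq> 0" for k using \<rho> by (simp add: y_def)
  have "\<rho> ^ 2 ^ Suc 0 < 1" using \<rho> by (simp add: power_less_one_iff)
  then have "norm (B (y 0)) \<le> norm (y 0)"
    by (intro Schwarz_Lemma(1)[OF hol B0 lt1]) (simp_all add: ny)
  then have "\<sigma>\<^sup>2 \<le> \<rho>\<^sup>2" using By[of 0] ny[of 0] by simp
  then have le: "\<sigma> \<le> \<rho>" using \<rho> by (simp add: abs_le_square_iff[symmetric])
  show "\<sigma> = \<rho> \<or> deriv B 0 = 0"
  proof (cases "\<sigma> = \<rho>")
    case False
    then have "\<sigma> / \<rho> < 1" "0 \<le> \<sigma> / \<rho>" using le \<rho> \<sigma> by auto
    then have "(\<lambda>k. (\<sigma> / \<rho>) ^ 2 ^ Suc k) \<longlonglongrightarrow> 0" by (intro pw)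
    then have "(\<lambda>k. norm (B (y k) / y k)) \<longlonglongrightarrow> 0"
      by (simp add: norm_divide By ny power_divide)
    then have "(\<lambda>k. B (y k) / y k) \<longlonglongrightarrow> 0" by (rule tendsto_norm_zero_cancel)
    moreover have "((\<lambda>z. B z / z) \<longlongrightarrow> deriv B 0) (at 0)"
      using der by (simp add: DERIV_def B0)
    then have "(\<lambda>k. B (y k) / y k) \<longlonglongrightarrow> deriv B 0"
      by (rule tendsto_compose_eventually[OF _ y0, simplified comp_def]) (simp add: ne)
    ultimately show ?thesis using LIMSEQ_unique by blast
  qed simp
qed

section \<open>Disc automorphisms and pencils of circles\<close>

definition disc_moebius :: "complex \<Rightarrow> complex \<Rightarrow> complex" where
  "disc_moebius p z = (z - p) / (1 - cnj p * z)"

lemma disc_moebius_denom: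
  assumes "norm p < 1" "norm z \<le> 1" shows "1 - cnj p * z \<noteq> 0"
proof
  assume "1 - cnj p * z = 0"
  then have "norm (cnj p * z) = 1" by simp
  then have "norm p * norm z = 1" by (simp add: norm_mult)
  moreover have "norm p * norm z \<le> norm p * 1" using assms by (intro mult_left_mono) auto
  ultimately show False using assms by simp
qed

lemma disc_moebius_norm_identity:
  "(norm (1 - cnj p * z))\<^sup>2 - (norm (z - p))\<^sup>2 = (1 - (norm p)\<^sup>2) * (1 - (norm z)\<^sup>2)"
  unfolding cmod_power2 by (simp add: algebra_simps power2_eq_square)

lemma norm_disc_moebius_lt_1:
  assumes "norm p < 1" "norm z < 1" shows "norm (disc_moebius p z) < 1"
proof -
  have "(1 - (norm p)\<^sup>2) * (1 - (norm z)\<^sup>2) > 0"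
    using assms by (simp add: power_less_one_iff)
  then have "(norm (z - p))\<^sup>2 < (norm (1 - cnj p * z))\<^sup>2"
    using disc_moebius_norm_identity[of p z] by linarith
  then have "norm (z - p) < norm (1 - cnj p * z)" by (rule power_less_imp_less_base) simp
  then show ?thesis
    unfolding disc_moebius_def norm_divide
    by (metis divide_less_eq_1_pos norm_ge_zero order_le_less_trans)
qed

lemma norm_disc_moebius_eq_1:
  assumes "norm p < 1" "norm z = 1" shows "norm (disc_moebius p z) = 1"
proof -
  have "(norm (z - p))\<^sup>2 = (norm (1 - cnj p * z))\<^sup>2"
    using disc_moebius_norm_identity[of p z] assms by simp
  then have "norm (z - p) = norm (1 - cnj p * z)" by simp
  then show ?thesis
    unfolding disc_moebius_def norm_divide using disc_moebius_denom[of p z] assms by simp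
qed

lemma disc_moebius_inverse:
  assumes "norm p < 1" "norm z \<le> 1"
  shows "disc_moebius (- p) (disc_moebius p z) = z"
proof -
  define D where "D = 1 - cnj p * z"
  have D: "D \<noteq> 0" unfolding D_def by (rule disc_moebius_denom[OF assms])
  have p1: "1 - cnj p * p \<noteq> 0" using assms by (intro disc_moebius_denom) auto
  have "(z - p) / D + p = z * (1 - cnj p * p) / D"
    using D by (simp add: field_simps) (simp add: D_def algebra_simps)
  moreover have "1 + cnj p * ((z - p) / D) = (1 - cnj p * p) / D"
    using D by (simp add: field_simps) (simp add: D_def algebra_simps)
  ultimately show ?thesis
    using D p1 unfolding disc_moebius_def D_def[symmetric] by simp
qed

lemma disc_moebius_continuous: "norm p < 1 \<Longrightarrow> continuous_on (cball 0 1) (disc_moebius p)"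
  unfolding disc_moebius_def using disc_moebius_denom by (auto intro!: continuous_intros)

lemma disc_moebius_holomorphic: "norm p < 1 \<Longrightarrow> disc_moebius p holomorphic_on ball 0 1"
  unfolding disc_moebius_def using disc_moebius_denom[of p] less_imp_le
  by (intro holomorphic_intros) auto

lemma norm_disc_moebius_le_1: "norm p < 1 \<Longrightarrow> norm z \<le> 1 \<Longrightarrow> norm (disc_moebius p z) \<le> 1"
  using norm_disc_moebius_lt_1 norm_disc_moebius_eq_1 by (metis le_less)


text \<open>
  The circle \<open>C\<close> with centre \<open>(1 - t) * w\<close> and radius \<open>t\<close> and the unit circle belong to a pencil
  whose limit point in the disc is \<open>x * w\<close>. The parameters \<open>t\<close> and \<open>\<rho>\<close> (the radius of the image
  of \<open>C\<close> when the limit point is moved to 0) are rational functions of \<open>x\<close>, with \<open>W = |w|^2\<close>.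
\<close>
definition pencil_t :: "real \<Rightarrow> real \<Rightarrow> real" where
  "pencil_t W x = (1 - x) * (1 - x * W) / (x * (1 - W))"

definition pencil_rho :: "real \<Rightarrow> real \<Rightarrow> real" where
  "pencil_rho W x = (1 - x) / (x * (1 - x * W))"

lemma pencil_t_surj:
  assumes W: "0 < W" "W < 1" and t: "0 < t" "t < 1"
  obtains x where "0 < x" "x < 1" "pencil_t W x = t"
proof -
  \<comment> \<open>The equation for \<open>x\<close> with denominators cleared: \<open>f\<close> is
    1 at 0 and \<open>- t * (1 - W)\<close> at 1.\<close>
  define f where "f x = (1 - x) * (1 - x * W) - t * (x * (1 - W))" for x
  have "\<exists>x. 0 \<le> x \<and> x \<le> 1 \<and> f x = 0"
    using W t by (intro IVT2) (auto simp: f_def intro!: continuous_intros)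
  then obtain x where x: "0 \<le> x" "x \<le> 1" "f x = 0" by blast
  have "x \<noteq> 0" "x \<noteq> 1" using x W t by (auto simp: f_def)
  then have "0 < x" "x < 1" using x by auto
  moreover have "pencil_t W x = t"
    using x(3) \<open>x \<noteq> 0\<close> W by (simp add: pencil_t_def f_def field_simps)
  ultimately show ?thesis by (rule that)
qed

lemma pencil_bounds:
  fixes W x :: real
  assumes W: "0 < W" "W < 1" and x: "0 < x" "x < 1"
  shows "x * W < 1" "0 < x * (1 - W)" "0 < x * (1 - x * W)"
proof -
  show *: "x * W < 1" using mult_strict_mono[of x 1 W 1] W x by simp
  show "0 < x * (1 - W)" "0 < x * (1 - x * W)" using W x * by auto
qed

lemma pencil_rho_bounds:
  assumes W: "0 < W" "W < 1" and x: "0 < x" "x < 1" and t: "pencil_t W x < 1"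
  shows "0 < pencil_rho W x" "pencil_rho W x < 1"
proof -
  note b = pencil_bounds[OF W x]
  show "0 < pencil_rho W x" using b x by (simp add: pencil_rho_def)
  have "(1 - x) * (1 - x * W) < x * (1 - W)"
    using t b by (simp add: pencil_t_def divide_less_eq)
  \<comment> \<open>Both inequalities say that \<open>1 + x\<^sup>2 * W < 2 * x\<close>.\<close>
  then have "1 - x < x * (1 - x * W)" by (simp add: algebra_simps)
  then show "pencil_rho W x < 1" using b by (simp add: pencil_rho_def divide_less_eq)
qed

lemma pencil_rho_inj:
  assumes W: "0 < W" "W < 1" and x: "0 < x" "x < 1" and y: "0 < y" "y < 1"
    and eq: "pencil_rho W x = pencil_rho W y"
  shows "x = y"
proof -
  have "(1 - x) * (y * (1 - y * W)) = (1 - y) * (x * (1 - x * W))"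
    using eq pencil_bounds(3)[OF W x] pencil_bounds(3)[OF W y]
    unfolding pencil_rho_def by (subst (asm) frac_eq_eq) auto
  \<comment> \<open>The cross-multiplied difference has the factor \<open>y - x\<close>; the
    cofactor is arranged as a sum of positive terms.\<close>
  then have "(y - x) * (1 - W + W * ((1 - x) * (1 - y))) = 0" by algebra
  moreover have "0 < 1 - W + W * ((1 - x) * (1 - y))"
    using W x y by (intro add_pos_pos mult_pos_pos) auto
  ultimately show ?thesis by simp
qed

text \<open>Here \<open>N\<close> and \<open>D\<close> stand for the squared modulus of
  \<open>z\<close> and the real inner product of \<open>z\<close> and \<open>w\<close>. The second
  assumption is the equation of \<open>C\<^sub>t\<close>; the conclusion compares the squared moduli
  of numerator and denominator of the Moebius map at \<open>x * w\<close>.\<close>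

lemma pencil_circle_identity:
  fixes x t W N D :: real
  assumes t: "t * (x * (1 - W)) = (1 - x) * (1 - x * W)"
    and N: "N - 2 * (1 - t) * D + (1 - t)\<^sup>2 * W = t\<^sup>2" and W: "W \<noteq> 1"
  shows "(x * (1 - x * W))\<^sup>2 * (N - 2 * x * D + x\<^sup>2 * W) =
         (1 - x)\<^sup>2 * (1 - 2 * x * D + x\<^sup>2 * (W * N))"
proof -
  \<comment> \<open>This is \<open>1 - t\<close> with the denominator of \<open>t\<close> cleared.
    It makes the circle equation polynomial in \<open>x\<close> and \<open>W\<close>, and a factor
    \<open>1 - W\<close> then cancels.\<close>
  define v where "v = x * (1 - W) * (1 - t)"
  have v: "v = 2 * x - 1 - x\<^sup>2 * W"
    using t unfolding v_def by algebra
  have "(x * (1 - W))\<^sup>2 * N - 2 * (x * (1 - W)) * v * D + v\<^sup>2 * W = (t * (x * (1 - W)))\<^sup>2"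
    using N unfolding v_def by algebra
  then have "(x * (1 - W))\<^sup>2 * N - 2 * (x * (1 - W)) * (2 * x - 1 - x\<^sup>2 * W) * D
      + (2 * x - 1 - x\<^sup>2 * W)\<^sup>2 * W = ((1 - x) * (1 - x * W))\<^sup>2"
    unfolding v t .
  then have "(1 - W) * ((x * (1 - x * W))\<^sup>2 * (N - 2 * x * D + x\<^sup>2 * W)) =
    (1 - W) * ((1 - x)\<^sup>2 * (1 - 2 * x * D + x\<^sup>2 * (W * N)))"
    by algebra
  then show ?thesis using W by simp
qed

lemma norm_disc_moebius_pencil:
  fixes w z :: complex and x :: real
  defines "W \<equiv> (norm w)\<^sup>2"
  assumes W: "0 < W" "W < 1" and x: "0 < x" "x < 1"
    and z: "z \<in> sphere ((1 - of_real (pencil_t W x)) * w) (pencil_t W x)"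
    and nz: "norm z \<le> 1"
  shows "norm (disc_moebius (of_real x * w) z) = pencil_rho W x"
proof -
  define t where "t = pencil_t W x"
  note b = pencil_bounds[OF W x]
  define N where "N = (norm z)\<^sup>2"
  define D where "D = Re z * Re w + Im z * Im w"
  have t: "t * (x * (1 - W)) = (1 - x) * (1 - x * W)"
    using b(2) unfolding t_def pencil_t_def by (metis less_irrefl nonzero_eq_divide_eq)
  have "norm (z - of_real (1 - t) * w) = t"
    using z by (simp add: t_def dist_norm norm_minus_commute)
  then have "(norm (z - of_real (1 - t) * w))\<^sup>2 = t\<^sup>2" by simp
  then have N: "N - 2 * (1 - t) * D + (1 - t)\<^sup>2 * W = t\<^sup>2"
    unfolding N_def D_def W_def cmod_power2 by (simp add: power2_eq_square algebra_simps)
  have "W \<noteq> 1" using W by simp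
  note id = pencil_circle_identity[OF t N this]
  have 1: "(norm (z - of_real x * w))\<^sup>2 = N - 2 * x * D + x\<^sup>2 * W"
    unfolding N_def D_def W_def cmod_power2 by (simp add: power2_eq_square algebra_simps)
  have 2: "(norm (1 - cnj (of_real x * w) * z))\<^sup>2 = 1 - 2 * x * D + x\<^sup>2 * (W * N)"
    unfolding N_def D_def W_def cmod_power2 by (simp add: power2_eq_square algebra_simps)
  have "(x * (1 - x * W) * norm (z - of_real x * w))\<^sup>2 =
        ((1 - x) * norm (1 - cnj (of_real x * w) * z))\<^sup>2"
    unfolding power_mult_distrib[of "x * (1 - x * W)"] power_mult_distrib[of "1 - x"] 1 2
    by (rule id)
  moreover have "0 \<le> x * (1 - x * W) * norm (z - of_real x * w)"
    using b(3) by (intro mult_nonneg_nonneg[OF less_imp_le]) auto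
  moreover have "0 \<le> (1 - x) * norm (1 - cnj (of_real x * w) * z)" using x by simp
  ultimately have eq: "x * (1 - x * W) * norm (z - of_real x * w) =
        (1 - x) * norm (1 - cnj (of_real x * w) * z)"
    by (simp only: power2_eq_iff_nonneg)
  have "norm w < 1" using W by (simp add: W_def power_less_one_iff)
  then have "norm (of_real x * w) < 1 * 1"
    unfolding norm_mult using x by (intro mult_strict_mono) auto
  then have "1 - cnj (of_real x * w) * z \<noteq> 0" using nz by (intro disc_moebius_denom) auto
  then show ?thesis
    using eq b(3) unfolding disc_moebius_def norm_divide pencil_rho_def
    by (subst frac_eq_eq) (auto simp: mult_ac)
qed

text \<open>Moving the limit points \<open>p\<close> and \<open>q\<close> to 0 by disc automorphisms
  turns \<open>\<Psi>\<close> into a map \<open>B\<close> between concentric circles. Equal radii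
  force \<open>x = y\<close> by injectivity of \<open>pencil_rho\<close>; otherwise \<open>B\<close>
  is critical at 0 and the chain rule makes \<open>\<Psi>\<close> critical at
  \<open>p\<close>.\<close>

lemma disc_map_pencil:
  fixes w :: complex and \<Psi> :: "complex \<Rightarrow> complex"
  defines "W \<equiv> (norm w)\<^sup>2"
  assumes W: "0 < W" "W < 1"
    and cont: "continuous_on (cball 0 1) \<Psi>" and hol: "\<Psi> holomorphic_on ball 0 1"
    and bd: "\<And>z. norm z = 1 \<Longrightarrow> norm (\<Psi> z) = 1"
    and lt1: "\<And>z. norm z < 1 \<Longrightarrow> norm (\<Psi> z) < 1"
    and x: "0 < x" "x < 1" and y: "0 < y" "y < 1"
    and tx: "pencil_t W x < 1" and ty: "pencil_t W y < 1"
    and E: "infinite E" "E \<subseteq> ball 0 1"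
      "E \<subseteq> sphere ((1 - of_real (pencil_t W x)) * w) (pencil_t W x)"
      "\<Psi> ` E \<subseteq> sphere ((1 - of_real (pencil_t W y)) * w) (pencil_t W y)"
  shows "\<Psi> (of_real x * w) = of_real y * w"
    and "y = x \<or> deriv \<Psi> (of_real x * w) = 0"
proof -
  define p q where "p = of_real x * w" and "q = of_real y * w"
  have "norm w < 1" using W by (simp add: W_def power_less_one_iff)
  then have "norm p < 1 * 1" "norm q < 1 * 1"
    unfolding p_def q_def norm_mult using x y by (intro mult_strict_mono; simp)+
  then have p: "norm p < 1" and q: "norm q < 1" by auto
  then have p': "norm (- p) < 1" and q': "norm (- q) < 1" by auto
  define B where "B = disc_moebius q \<circ> \<Psi> \<circ> disc_moebius (- p)"
  have le1: "norm z \<le> 1 \<Longrightarrow> norm (\<Psi> z) \<le> 1" for z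
    using bd lt1 by (metis le_less)
  have contB: "continuous_on (cball 0 1) B"
    unfolding B_def using p' le1 norm_disc_moebius_le_1[OF p']
    by (intro continuous_on_compose disc_moebius_continuous continuous_on_subset[OF cont]
        continuous_on_subset[OF disc_moebius_continuous[OF q]]) auto
  have holB: "B holomorphic_on ball 0 1"
  proof -
    have "\<Psi> \<circ> disc_moebius (- p) holomorphic_on ball 0 1"
      by (rule holomorphic_on_compose_gen[OF disc_moebius_holomorphic[OF p'] hol])
        (use norm_disc_moebius_lt_1[OF p'] in auto)
    then have "disc_moebius q \<circ> (\<Psi> \<circ> disc_moebius (- p)) holomorphic_on ball 0 1"
      by (rule holomorphic_on_compose_gen[OF _ disc_moebius_holomorphic[OF q]])
        (use lt1 norm_disc_moebius_lt_1[OF p'] in auto)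
    then show ?thesis by (simp add: B_def comp_assoc)
  qed
  have B1: "norm (B z) = 1" if "norm z = 1" for z
    unfolding B_def using that p' q by (simp add: norm_disc_moebius_eq_1 bd)
  have Blt1: "norm (B z) < 1" if "norm z < 1" for z
    unfolding B_def using that p' q by (simp add: norm_disc_moebius_lt_1 lt1)
  note rx = pencil_rho_bounds[OF W x tx] and ry = pencil_rho_bounds[OF W y ty]
  have inv: "disc_moebius (- p) (disc_moebius p z) = z" if "norm z \<le> 1" for z
    using disc_moebius_inverse[OF p that] .
  have inj: "inj_on (disc_moebius p) E"
    using E(2) by (intro inj_on_inverseI[of _ "disc_moebius (- p)"]) (auto intro!: inv)
  have infE: "infinite (disc_moebius p ` E)" using E(1) inj by (simp add: finite_image_iff)
  have subE: "disc_moebius p ` E \<subseteq> sphere 0 (pencil_rho W x)"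
  proof clarify
    fix z assume "z \<in> E"
    then have "norm (disc_moebius p z) = pencil_rho W x"
      using norm_disc_moebius_pencil[of w x z] W x E(2,3) unfolding p_def W_def by force
    then show "disc_moebius p z \<in> sphere 0 (pencil_rho W x)" by simp
  qed
  have BE: "norm (B z) = pencil_rho W y" if z: "z \<in> disc_moebius p ` E" for z
  proof -
    obtain e where e: "e \<in> E" "z = disc_moebius p e" using z by blast
    have e1: "norm e < 1" using e(1) E(2) by auto
    have "\<Psi> e \<in> sphere ((1 - of_real (pencil_t W y)) * w) (pencil_t W y)"
      using e(1) E(4) by blast
    then have "norm (disc_moebius q (\<Psi> e)) = pencil_rho W y"
      using norm_disc_moebius_pencil[of w y "\<Psi> e"] W y lt1[OF e1] unfolding q_def W_def by simp
    then show ?thesis using e inv[of e] e1 by (simp add: B_def)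
  qed
  note core = circle_to_circle_at_0[OF contB holB B1 Blt1 rx _ ry(2) infE subE BE]
  have B0: "B 0 = 0" by (rule core) (use ry in auto)
  have alt: "pencil_rho W y = pencil_rho W x \<or> deriv B 0 = 0" by (rule core) (use ry in auto)
  have m0: "disc_moebius a a = 0" for a by (simp add: disc_moebius_def)
  have unwind: "\<Psi> z = (disc_moebius (- q) \<circ> B \<circ> disc_moebius p) z" if "norm z < 1" for z
    using that inv[of z] disc_moebius_inverse[OF q, of "\<Psi> z"] le1[of z] by (simp add: B_def)
  show 1: "\<Psi> (of_real x * w) = of_real y * w"
    using unwind[OF p] B0 unfolding p_def[symmetric] q_def[symmetric]
    by (simp add: m0) (simp add: disc_moebius_def)
  show "y = x \<or> deriv \<Psi> (of_real x * w) = 0"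
  proof (cases "deriv B 0 = 0")
    case False
    then show ?thesis using alt pencil_rho_inj[OF W y x] by simp
  next
    case True
    obtain a where a: "(disc_moebius p has_field_derivative a) (at p)"
      using disc_moebius_holomorphic[OF p] p holomorphic_derivI[of _ "ball 0 1" p] by auto
    obtain c where c: "(disc_moebius (- q) has_field_derivative c) (at 0)"
      using disc_moebius_holomorphic[OF q'] holomorphic_derivI[of _ "ball 0 1" 0] by auto
    have "(B has_field_derivative 0) (at 0)"
      using holB True holomorphic_derivI[of B "ball 0 1" 0] by auto
    then have "(B has_field_derivative 0) (at (disc_moebius p p))" by (simp add: m0)
    from DERIV_chain[OF this a] have "(B \<circ> disc_moebius p has_field_derivative 0) (at p)" by simp
    moreover have "(disc_moebius (- q) has_field_derivative c) (at ((B \<circ> disc_moebius p) p))"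
      using c by (simp add: m0 B0)
    ultimately have "(disc_moebius (- q) \<circ> (B \<circ> disc_moebius p) has_field_derivative c * 0) (at p)"
      by (intro DERIV_chain)
    then have "(\<Psi> has_field_derivative 0) (at p)"
      using unwind p
      by (intro has_field_derivative_transform_within_open[of _ 0 p "ball 0 1" \<Psi>]) (auto simp: comp_def)
    then show ?thesis by (simp add: p_def DERIV_imp_deriv)
  qed
qed

text \<open>The limit points \<open>X t * w\<close> stay in the closed disc of radius
  \<open>norm w\<close>, so infinitely many of them accumulate inside the unit disc and the identity
  theorem applies. It is used for \<open>\<Psi> z - z\<close> or for the derivative of
  \<open>\<Psi>\<close>, according to which alternative occurs for infinitely many circles.\<close>

lemma disc_map_identity_if_circles:
  fixes w :: complex and \<Psi> :: "complex \<Rightarrow> complex" and \<tau> :: "real \<Rightarrow> real"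
  assumes w: "norm w < 1" "w \<noteq> 0"
    and cont: "continuous_on (cball 0 1) \<Psi>" and hol: "\<Psi> holomorphic_on ball 0 1"
    and bd: "\<And>z. norm z = 1 \<Longrightarrow> norm (\<Psi> z) = 1"
    and lt1: "\<And>z. norm z < 1 \<Longrightarrow> norm (\<Psi> z) < 1"
    and S: "infinite S" "S \<subseteq> {0<..<1}" and \<tau>: "inj_on \<tau> S" "\<tau> ` S \<subseteq> {0<..<1}"
    and E: "\<And>s. s \<in> S \<Longrightarrow> infinite (E s)" "\<And>s. s \<in> S \<Longrightarrow> E s \<subseteq> ball 0 1"
      "\<And>s. s \<in> S \<Longrightarrow> E s \<subseteq> sphere ((1 - of_real (\<tau> s)) * w) (\<tau> s)"
      "\<And>s. s \<in> S \<Longrightarrow> \<Psi> ` E s \<subseteq> sphere ((1 - of_real s) * w) s"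
    and z: "norm z < 1"
  shows "\<Psi> z = z"
proof -
  define W where "W = (norm w)\<^sup>2"
  have W: "0 < W" "W < 1" using w by (auto simp: W_def power_less_one_iff)
  have "\<forall>t\<in>{0<..<1}. \<exists>x. 0 < x \<and> x < 1 \<and> pencil_t W x = t"
    using pencil_t_surj[OF W] by (metis greaterThanLessThan_iff)
  then obtain X where X: "\<And>t. 0 < t \<Longrightarrow> t < 1 \<Longrightarrow> 0 < X t \<and> X t < 1 \<and> pencil_t W (X t) = t"
    by (metis greaterThanLessThan_iff)
  have injX: "inj_on (\<lambda>t. of_real (X t) * w) {0<..<1}"
    using w X by (auto simp: inj_on_def) metis
  have subX: "(\<lambda>t. of_real (X t) * w) ` {0<..<1} \<subseteq> cball 0 (norm w)"
    using X by (force simp: norm_mult intro: mult_left_le_one_le)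
  have sub1: "cball 0 (norm w) \<subseteq> ball 0 1" using w by auto
  have vanish: "g u = 0" if g: "g holomorphic_on ball 0 1" and T: "infinite T" "T \<subseteq> {0<..<1}"
    and gT: "\<And>t. t \<in> T \<Longrightarrow> g (of_real (X t) * w) = 0" and u: "norm u < 1" for g T u
  proof -
    let ?U = "(\<lambda>t. of_real (X t) * w) ` T"
    have "infinite ?U" using T injX by (metis finite_image_iff inj_on_subset)
    moreover have U: "?U \<subseteq> cball 0 (norm w)" using subX T(2) by blast
    ultimately obtain \<xi> where \<xi>: "\<xi> \<in> cball 0 (norm w)" "\<xi> islimpt ?U"
      using Heine_Borel_imp_Bolzano_Weierstrass[OF compact_cball] by blast
    show "g u = 0"
      by (rule analytic_continuation[OF g open_ball connected_ball _ _ \<xi>(2)])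
        (use U \<xi>(1) sub1 w gT u in auto)
  qed
  have alt: "\<Psi> (of_real (X (\<tau> s)) * w) = of_real (X s) * w \<and>
      (X s = X (\<tau> s) \<or> deriv \<Psi> (of_real (X (\<tau> s)) * w) = 0)" if s: "s \<in> S" for s
  proof -
    have "0 < s" "s < 1" "0 < \<tau> s" "\<tau> s < 1" using s S(2) \<tau>(2) by auto
    note Xs = X[OF this(1,2)] X[OF this(3,4)] and this
    then show ?thesis
      using disc_map_pencil[of w \<Psi> "X (\<tau> s)" "X s" "E s"] W cont hol bd lt1 E[OF s]
      unfolding W_def by auto
  qed
  define S1 where "S1 = {s \<in> S. X s = X (\<tau> s)}"
  define S2 where "S2 = {s \<in> S. deriv \<Psi> (of_real (X (\<tau> s)) * w) = 0}"
  have "S \<subseteq> S1 \<union> S2" using alt by (auto simp: S1_def S2_def)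
  then have "infinite S1 \<or> infinite S2" using S(1) by (meson finite_UnI finite_subset)
  then show ?thesis
  proof
    assume inf: "infinite S1"
    have "\<Psi> z - z = 0"
      by (rule vanish[of "\<lambda>z. \<Psi> z - z" S1])
        (use inf S(2) alt z hol in \<open>auto simp: S1_def intro!: holomorphic_intros\<close>)
    then show ?thesis by simp
  next
    assume inf: "infinite S2"
    \<comment> \<open>The critical points are indexed by \<open>\<tau> s\<close>, so injectivity of
      \<open>\<tau>\<close> is what makes them infinitely many.\<close>
    have "infinite (\<tau> ` S2)"
      using inf \<tau>(1) by (metis (no_types, lifting) S2_def finite_image_iff inj_on_subset mem_Collect_eq subsetI)
    moreover have "deriv \<Psi> holomorphic_on ball 0 1" by (rule holomorphic_deriv[OF hol open_ball])
    moreover have "\<tau> ` S2 \<subseteq> {0<..<1}" using \<tau>(2) by (auto simp: S2_def)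
    moreover have "\<And>t. t \<in> \<tau> ` S2 \<Longrightarrow> deriv \<Psi> (of_real (X t) * w) = 0" by (auto simp: S2_def)
    ultimately have der0: "deriv \<Psi> u = 0" if "norm u < 1" for u
      using vanish[of "deriv \<Psi>" "\<tau> ` S2" u] that by blast
    have const: "\<Psi> u = \<Psi> 0" if "u \<in> ball 0 1" for u
    proof -
      have "(\<Psi> has_field_derivative 0) (at v within ball 0 1)" if "v \<in> ball 0 1" for v
      proof -
        have "norm v < 1" using that by simp
        from holomorphic_derivI[OF hol open_ball that] show ?thesis
          unfolding der0[OF \<open>norm v < 1\<close>] .
      qed
      from has_field_derivative_zero_constant[OF convex_ball this]
      have "\<exists>c. \<forall>v\<in>ball 0 1. \<Psi> v = c" by blast
      then show ?thesis using that by (metis centre_in_ball zero_less_one)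
    qed
    \<comment> \<open>A constant map would have the same modulus on the boundary, where it is 1, as
      inside, where it is smaller.\<close>
    have "\<Psi> 1 = \<Psi> 0"
    proof (rule continuous_constant_on_closure[where S = "ball 0 1" and f = \<Psi>])
      show "\<Psi> u = \<Psi> 0" if "u \<in> ball 0 1" for u using that by (rule const)
    qed (use cont in auto)
    then show ?thesis using bd[of 1] lt1[of 0] by simp
  qed
qed

section \<open>Composition with a self-map of the disc\<close>

lemma abel_map_in_disc:
  assumes "norm w < 1" "norm \<zeta> = 1" "0 \<le> t" "t < 1"
  shows "norm (abel_map w t \<zeta>) < 1"
proof -
  have "abel_map w t \<zeta> \<in> cball (abel_centre w t) t"
    using abel_map_on_sphere[OF assms(2,3), of w] by auto
  then show ?thesis by (rule abel_disc_in_unit_disc[OF assms(1,4)])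
qed

lemma abel_universal_wrt_cong:
  assumes r: "abel_radii r" and w: "norm w < 1" and f: "f \<in> abel_universal_wrt w r"
    and eq: "\<And>z. z \<in> ball 0 1 \<Longrightarrow> g z = f z"
  shows "g \<in> abel_universal_wrt w r"
  unfolding abel_universal_wrt_def
proof (clarsimp, intro conjI allI impI)
  have "f holomorphic_on ball 0 1" using f by (simp add: abel_universal_wrt_def)
  then show "g holomorphic_on ball 0 1" by (rule holomorphic_transform) (simp add: eq)
  fix K and \<phi> :: "complex \<Rightarrow> complex"
  assume K: "compact K \<and> K \<subseteq> sphere 0 1 \<and> K \<noteq> sphere 0 1 \<and> continuous_on K \<phi>"
  then obtain n :: "nat \<Rightarrow> nat" where n: "strict_mono n"
    "uniform_limit K (\<lambda>k \<zeta>. f (w + of_real (r (n k)) * (\<zeta> - w))) \<phi> sequentially"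
    using f unfolding abel_universal_wrt_def by blast
  have "g (w + of_real (r (n k)) * (\<zeta> - w)) = f (w + of_real (r (n k)) * (\<zeta> - w))" if "\<zeta> \<in> K" for k \<zeta>
  proof -
    have "norm \<zeta> = 1" using that K by auto
    then have "norm (abel_map w (r (n k)) \<zeta>) < 1"
      using r by (intro abel_map_in_disc w) (auto simp: abel_radii_def)
    then show ?thesis by (intro eq) (simp add: abel_map_def)
  qed
  then have "uniform_limit K (\<lambda>k \<zeta>. g (w + of_real (r (n k)) * (\<zeta> - w))) \<phi> sequentially"
    using n(2) by (simp cong: uniform_limit_cong')
  then show "\<exists>n::nat \<Rightarrow> nat. strict_mono n \<and>
      uniform_limit K (\<lambda>k \<zeta>. g (w + of_real (r (n k)) * (\<zeta> - w))) \<phi> sequentially"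
    using n(1) by blast
qed

text \<open>The form in which universality of a composition is exploited. The radii are those of an
  unknown sequence, but as they tend to 1 they can be taken beyond any
  \<open>t0 < 1\<close>.\<close>

lemma abel_universal_approx_const:
  assumes w: "norm w < 1" and g: "g \<in> abel_universal w"
    and K: "compact K" "K \<subseteq> sphere 0 1" "K \<noteq> sphere 0 1" and e: "\<epsilon> > 0" and t0: "t0 < 1"
  obtains t where "t0 < t" "0 \<le> t" "t < 1" "\<And>\<zeta>. \<zeta> \<in> K \<Longrightarrow> norm (g (abel_map w t \<zeta>) - c) < \<epsilon>"
proof -
  obtain r where r: "abel_radii r" "g \<in> abel_universal_wrt w r"
    using g by (auto simp: abel_universal_def)
  then obtain n :: "nat \<Rightarrow> nat" where n: "strict_mono n"
    "uniform_limit K (\<lambda>k \<zeta>. g (w + of_real (r (n k)) * (\<zeta> - w))) (\<lambda>_. c) sequentially"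
    using K continuous_on_const[of K c] unfolding abel_universal_wrt_def by blast
  have "(\<lambda>k. r (n k)) \<longlonglongrightarrow> 1"
    using LIMSEQ_subseq_LIMSEQ[OF _ n(1), of r 1] r(1) by (simp add: abel_radii_def comp_def)
  then have "\<forall>\<^sub>F k in sequentially. t0 < r (n k)" using t0 by (simp add: order_tendsto_iff)
  moreover have "\<forall>\<^sub>F k in sequentially. \<forall>\<zeta>\<in>K. dist (g (w + of_real (r (n k)) * (\<zeta> - w))) c < \<epsilon>"
    using n(2) e unfolding uniform_limit_iff by blast
  ultimately have "\<forall>\<^sub>F k in sequentially. t0 < r (n k) \<and>
      (\<forall>\<zeta>\<in>K. dist (g (w + of_real (r (n k)) * (\<zeta> - w))) c < \<epsilon>)"
    by (rule eventually_conj)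
  from eventually_happens'[OF sequentially_bot this]
  obtain k where "t0 < r (n k)" "\<forall>\<zeta>\<in>K. dist (g (w + of_real (r (n k)) * (\<zeta> - w))) c < \<epsilon>" by blast
  then show ?thesis
    using r(1) by (intro that[of "r (n k)"]) (auto simp: abel_radii_def abel_map_def dist_norm)
qed

lemma norm_abel_map_diff:
  assumes "norm w < 1" "norm \<zeta> = 1" "t \<le> 1"
  shows "norm (abel_map w t \<zeta> - \<zeta>) \<le> 2 * (1 - t)"
proof -
  have "abel_map w t \<zeta> - \<zeta> = of_real (1 - t) * (w - \<zeta>)" by (simp add: abel_map_def algebra_simps)
  then have "norm (abel_map w t \<zeta> - \<zeta>) = (1 - t) * norm (w - \<zeta>)"
    using assms by (simp only: norm_mult norm_of_real)
  also have "\<dots> \<le> (1 - t) * 2"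
    using norm_triangle_ineq4[of w \<zeta>] assms by (intro mult_left_mono) auto
  finally show ?thesis by simp
qed

text \<open>Universality for the one-point set \<open>{\<zeta>}\<close> yields points arbitrarily
  near \<open>\<zeta>\<close> with values near \<open>l + 1\<close>.\<close>

lemma abel_universal_no_boundary_limit:
  assumes w: "norm w < 1" and g: "g \<in> abel_universal w" and \<zeta>: "norm \<zeta> = 1"
  shows "\<not> (g \<longlongrightarrow> l) (at \<zeta> within ball 0 1)"
proof
  assume "(g \<longlongrightarrow> l) (at \<zeta> within ball 0 1)"
  then have "\<forall>\<^sub>F z in at \<zeta> within ball 0 1. dist (g z) l < 1/2" by (rule tendstoD) simp
  then obtain d where d: "d > 0" "\<And>z. z \<in> ball 0 1 \<Longrightarrow> z \<noteq> \<zeta> \<Longrightarrow> dist z \<zeta> < d \<Longrightarrow> dist (g z) l < 1/2"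
    unfolding eventually_at by auto
  have "- \<zeta> \<noteq> \<zeta>" using \<zeta> by (auto simp: complex_eq_iff cmod_def)
  then have ne: "{\<zeta>} \<noteq> sphere 0 1" using \<zeta> by (metis mem_sphere_0 norm_minus_cancel singletonD)
  obtain t where t: "1 - d/2 < t" "0 \<le> t" "t < 1" "norm (g (abel_map w t \<zeta>) - (l + 1)) < 1/2"
    using abel_universal_approx_const[OF w g, of "{\<zeta>}" "1/2" "1 - d/2" "l + 1"] ne \<zeta> d(1) by auto
  have n1: "norm (abel_map w t \<zeta>) < 1" by (rule abel_map_in_disc[OF w \<zeta> t(2,3)])
  moreover have "dist (abel_map w t \<zeta>) \<zeta> < d"
    using norm_abel_map_diff[OF w \<zeta>, of t] t by (simp add: dist_norm)
  ultimately have "dist (g (abel_map w t \<zeta>)) l < 1/2" using \<zeta> by (intro d(2)) auto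
  then have "norm ((g (abel_map w t \<zeta>) - l) - (g (abel_map w t \<zeta>) - (l + 1))) < 1/2 + 1/2"
    using t(4) norm_triangle_ineq4[of "g (abel_map w t \<zeta>) - l" "g (abel_map w t \<zeta>) - (l + 1)"]
    unfolding dist_norm by linarith
  then show False by simp
qed

section \<open>Thin shells and small arcs\<close>

lemma shells_exist:
  fixes r \<epsilon> :: "nat \<Rightarrow> real"
  assumes r: "abel_radii r" and I: "infinite I" and \<epsilon>: "\<And>n. n \<in> I \<Longrightarrow> 0 < \<epsilon> n"
  obtains m :: "nat \<Rightarrow> nat" and a b :: "nat \<Rightarrow> real"
  where "strict_mono m" "\<And>k. m k \<in> I"
    "\<And>k. 0 < a k" "\<And>k. a k < r (m k)" "\<And>k. r (m k) < b k" "\<And>k. b k < a (Suc k)"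
    "\<And>k. r (m k) - \<epsilon> (m k) < a k" "\<And>k. b k < r (m k) + \<epsilon> (m k)"
proof -
  have later: "\<exists>n'. n' \<in> I \<and> n < n' \<and> c < r n'" if "c < 1" for c n
  proof -
    have "r \<longlonglongrightarrow> 1" using r by (simp add: abel_radii_def)
    then have "\<forall>\<^sub>F n in sequentially. c < r n" using that by (simp add: order_tendsto_iff)
    then obtain N where N: "\<And>n. n \<ge> N \<Longrightarrow> c < r n" by (auto simp: eventually_sequentially)
    obtain n' where "n' \<in> I" "n' > max n N" using I by (meson infinite_nat_iff_unbounded)
    then show ?thesis using N[of n'] by auto
  qed
  have r1: "r n < 1" "0 \<le> r n" for n using r by (auto simp: abel_radii_def)
  have "\<exists>m. \<forall>k. (m k \<in> I \<and> 0 < r (m k)) \<and> (m k < m (Suc k) \<and> r (m k) < r (m (Suc k)))"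
  proof (rule dependent_nat_choice)
    show "\<exists>n. n \<in> I \<and> 0 < r n" using later[of 0 0] by auto
    show "\<exists>n'. (n' \<in> I \<and> 0 < r n') \<and> n < n' \<and> r n < r n'" for n
      using later[OF r1(1)[of n], of n] r1(2)[of n] by (meson le_less_trans)
  qed
  then obtain m where m: "\<And>k. m k \<in> I" "\<And>k. 0 < r (m k)" "\<And>k. m k < m (Suc k)"
    "\<And>k. r (m k) < r (m (Suc k))" by blast
  define p where "p k = (case k of 0 \<Rightarrow> 0 | Suc j \<Rightarrow> r (m j))" for k
  define d where "d k = min (\<epsilon> (m k) / 2) (min ((r (m (Suc k)) - r (m k)) / 3) ((r (m k) - p k) / 3))" for k
  have p: "0 \<le> p k" "p k < r (m k)" for k using m r1 by (auto simp: p_def split: nat.split)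
  have d: "0 < d k" "d k < \<epsilon> (m k)" "d k \<le> (r (m (Suc k)) - r (m k)) / 3" "d k \<le> (r (m k) - p k) / 3" for k
    using \<epsilon>[OF m(1)[of k]] m(4)[of k] p(2)[of k] by (auto simp: d_def min_def)
  show ?thesis
  proof (rule that[of m "\<lambda>k. r (m k) - d k" "\<lambda>k. r (m k) + d k"])
    show "strict_mono m" using m(3) by (simp add: strict_mono_Suc_iff)
    show "0 < r (m k) - d k" for k using d(4)[of k] p[of k] m(2)[of k] by (simp add: field_simps)
    show "r (m k) + d k < r (m (Suc k)) - d (Suc k)" for k
      using d(3)[of k] d(4)[of "Suc k"] m(4)[of k] by (simp add: p_def)
  qed (use m(1) d in auto)
qed

lemma shell_thickness:
  fixes G :: "real \<Rightarrow> complex \<Rightarrow> complex"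
  assumes cont: "\<And>\<zeta>. \<zeta> \<in> K \<Longrightarrow> continuous_on {0..1} (\<lambda>t. G t \<zeta>)"
    and leave: "\<And>t. t \<in> {0..1} \<Longrightarrow> \<exists>\<zeta>\<in>K. G t \<zeta> \<notin> sphere (abel_centre w s) s"
  shows "\<exists>\<epsilon>>0. \<forall>t\<in>{0..1}. \<forall>a b. s - \<epsilon> < a \<and> a < s \<and> s < b \<and> b < s + \<epsilon> \<longrightarrow>
    (\<exists>\<zeta>\<in>K. G t \<zeta> \<notin> ball (abel_centre w b) b - cball (abel_centre w a) a)"
proof (rule ccontr)
  assume neg: "\<not> ?thesis"
  have "\<exists>t a b. t \<in> {0..1} \<and> \<bar>a - s\<bar> < 1 / real (Suc k) \<and> \<bar>b - s\<bar> < 1 / real (Suc k) \<and>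
      (\<forall>\<zeta>\<in>K. G t \<zeta> \<in> ball (abel_centre w b) b - cball (abel_centre w a) a)" for k
  proof -
    have "0 < 1 / real (Suc k)" by simp
    then obtain t a b where h: "t \<in> {0..1}" "s - 1 / real (Suc k) < a" "a < s" "s < b" "b < s + 1 / real (Suc k)"
      "\<forall>\<zeta>\<in>K. G t \<zeta> \<in> ball (abel_centre w b) b - cball (abel_centre w a) a"
      using neg by blast
    then have "\<bar>a - s\<bar> < 1 / real (Suc k)" "\<bar>b - s\<bar> < 1 / real (Suc k)" by linarith+
    then show ?thesis using h by blast
  qed
  then obtain t a b where t: "\<And>k. t k \<in> {0..1}" and a: "\<And>k. \<bar>a k - s\<bar> < 1 / real (Suc k)"
    and b: "\<And>k. \<bar>b k - s\<bar> < 1 / real (Suc k)"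
    and in_shell: "\<And>k \<zeta>. \<zeta> \<in> K \<Longrightarrow> G (t k) \<zeta> \<in> ball (abel_centre w (b k)) (b k) - cball (abel_centre w (a k)) (a k)"
    by metis
  have lim: "u \<longlonglongrightarrow> s" if "\<And>k. \<bar>u k - s\<bar> < 1 / real (Suc k)" for u
  proof -
    have "(\<lambda>k. u k - s) \<longlonglongrightarrow> 0"
    proof (rule Lim_null_comparison)
      show "\<forall>\<^sub>F k in sequentially. norm (u k - s) \<le> 1 / real (Suc k)"
        using that less_imp_le by (auto intro!: always_eventually)
      show "(\<lambda>k. 1 / real (Suc k)) \<longlonglongrightarrow> 0" by (rule LIMSEQ_Suc[OF lim_1_over_n])
    qed
    then show ?thesis by (simp add: LIM_zero_iff)
  qed
  obtain t0 \<sigma> where t0: "t0 \<in> {0..1}" "strict_mono \<sigma>" "(t \<circ> \<sigma>) \<longlonglongrightarrow> t0"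
    using compact_Icc[of "0::real" 1] t unfolding compact_def by metis
  obtain \<zeta> where \<zeta>: "\<zeta> \<in> K" "G t0 \<zeta> \<notin> sphere (abel_centre w s) s" using leave[OF t0(1)] by blast
  have G: "(\<lambda>k. G (t (\<sigma> k)) \<zeta>) \<longlonglongrightarrow> G t0 \<zeta>"
    using continuous_on_tendsto_compose[OF cont[OF \<zeta>(1)] t0(3) t0(1)] t by (simp add: comp_def)
  have a': "(\<lambda>k. a (\<sigma> k)) \<longlonglongrightarrow> s" and b': "(\<lambda>k. b (\<sigma> k)) \<longlonglongrightarrow> s"
    using LIMSEQ_subseq_LIMSEQ[OF lim t0(2)] a b by (simp_all add: comp_def)
  have da: "(\<lambda>k. dist (abel_centre w (a (\<sigma> k))) (G (t (\<sigma> k)) \<zeta>)) \<longlonglongrightarrow> dist (abel_centre w s) (G t0 \<zeta>)"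
    by (intro tendsto_intros a' G)
  have db: "(\<lambda>k. dist (abel_centre w (b (\<sigma> k))) (G (t (\<sigma> k)) \<zeta>)) \<longlonglongrightarrow> dist (abel_centre w s) (G t0 \<zeta>)"
    by (intro tendsto_intros b' G)
  have "s \<le> dist (abel_centre w s) (G t0 \<zeta>)"
  proof (rule LIMSEQ_le[OF a' da])
    have "a (\<sigma> k) \<le> dist (abel_centre w (a (\<sigma> k))) (G (t (\<sigma> k)) \<zeta>)" for k
      using in_shell[OF \<zeta>(1), of "\<sigma> k"] by auto
    then show "\<exists>N. \<forall>k\<ge>N. a (\<sigma> k) \<le> dist (abel_centre w (a (\<sigma> k))) (G (t (\<sigma> k)) \<zeta>)" by blast
  qed
  moreover have "dist (abel_centre w s) (G t0 \<zeta>) \<le> s"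
  proof (rule LIMSEQ_le[OF db b'])
    have "dist (abel_centre w (b (\<sigma> k))) (G (t (\<sigma> k)) \<zeta>) \<le> b (\<sigma> k)" for k
      using in_shell[OF \<zeta>(1), of "\<sigma> k"] by auto
    then show "\<exists>N. \<forall>k\<ge>N. dist (abel_centre w (b (\<sigma> k))) (G (t (\<sigma> k)) \<zeta>) \<le> b (\<sigma> k)" by blast
  qed
  ultimately show False using \<zeta>(2) by simp
qed

lemma connected_in_one_of_disjoint_opens:
  assumes Z: "connected Z" "Z \<noteq> {}" "Z \<subseteq> (\<Union>k. U k)"
    and op: "\<And>k. open (U k)" and disj: "\<And>j k. j \<noteq> k \<Longrightarrow> U j \<inter> U k = {}"
  obtains k where "Z \<subseteq> U k"
proof -
  obtain z k where z: "z \<in> Z" "z \<in> U k" using Z(2,3) by blast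
  let ?V = "\<Union>j\<in>-{k}. U j"
  have "U k \<inter> Z = {} \<or> ?V \<inter> Z = {}"
  proof (rule connectedD[OF Z(1) op])
    show "open ?V" using op by blast
    show "U k \<inter> ?V \<inter> Z = {}"
    proof -
      have "U k \<inter> U j = {}" if "j \<in> - {k}" for j using disj[of k j] that by auto
      then show ?thesis by blast
    qed
    show "Z \<subseteq> U k \<union> ?V"
    proof
      fix y assume "y \<in> Z"
      then obtain j where "y \<in> U j" using Z(3) by auto
      then show "y \<in> U k \<union> ?V" by (cases "j = k") auto
    qed
  qed
  then have V: "y \<notin> ?V" if "y \<in> Z" for y using z that by auto
  have "y \<in> U k" if y: "y \<in> Z" for y
  proof -
    obtain j where "y \<in> U j" using y Z(3) by auto
    then show ?thesis using V[OF y] by (cases "j = k") auto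
  qed
  then show ?thesis by (intro that[of k] subsetI)
qed

lemma small_arc:
  assumes "\<delta> > 0"
  obtains K :: "complex set" where "compact K" "connected K" "infinite K" "K \<subseteq> sphere 0 1"
    "K \<noteq> sphere 0 1" "K \<subseteq> ball 1 \<delta>"
proof -
  have "isCont cis 0"
    using continuous_on_cis[OF continuous_on_id, of UNIV] by (simp add: continuous_on_eq_continuous_at)
  moreover have "min \<delta> 1 > 0" using assms by simp
  ultimately obtain d where d: "d > 0" "\<And>x. \<bar>x\<bar> < d \<Longrightarrow> dist (cis x) (cis 0) < min \<delta> 1"
    unfolding continuous_at_eps_delta dist_real_def by (metis diff_zero)
  define \<theta> where "\<theta> = min (d / 2) 1"
  have \<theta>: "0 < \<theta>" "\<theta> < d" "\<theta> \<le> 1" using d(1) by (auto simp: \<theta>_def min_def)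
  let ?K = "cis ` {0..\<theta>}"
  have near: "dist 1 z < min \<delta> 1" if "z \<in> ?K" for z
    using that d(2) \<theta> by (auto simp: dist_commute)
  have conn: "connected ?K" by (intro connected_continuous_image continuous_intros) auto
  show ?thesis
  proof (rule that[of ?K])
    show "compact ?K" by (intro compact_continuous_image continuous_intros) auto
    show "connected ?K" by (rule conn)
    have "sin \<theta> > 0" using \<theta> pi_gt3 by (intro sin_gt_zero) auto
    then have "cis \<theta> \<noteq> cis 0" by (auto simp: complex_eq_iff)
    moreover have "cis \<theta> \<in> ?K" "cis 0 \<in> ?K" using \<theta> by (intro imageI; simp)+
    ultimately show "infinite ?K"
      using connected_finite_iff_sing[OF conn] by (metis empty_iff singletonD)
    show "?K \<noteq> sphere 0 1"
    proof
      assume "?K = sphere 0 1"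
      then have "- 1 \<in> ?K" by simp
      from near[OF this] show False by (simp add: dist_norm)
    qed
    show "?K \<subseteq> ball 1 \<delta>" using near by auto
  qed auto
qed

theorem theorem4p7:
  fixes r :: "nat \<Rightarrow> real" and w :: complex and \<Phi> :: "complex \<Rightarrow> complex"
  assumes "abel_radii r"
    and "w \<in> ball 0 1 - {0}"
    and "\<Phi> holomorphic_on ball 0 1"
    and "\<Phi> ` ball 0 1 \<subseteq> ball 0 1"
    and "\<exists>\<Psi>. continuous_on (cball 0 1) \<Psi> \<and> (\<forall>z\<in>ball 0 1. \<Psi> z = \<Phi> z)"
  shows "(\<forall>f \<in> abel_universal_wrt w r. f \<circ> \<Phi> \<in> abel_universal w) \<longleftrightarrow>
         (\<forall>z\<in>ball 0 1. \<Phi> z = z)"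
proof
  assume id: "\<forall>z\<in>ball 0 1. \<Phi> z = z"
  show "\<forall>f \<in> abel_universal_wrt w r. f \<circ> \<Phi> \<in> abel_universal w"
  proof
    fix f assume "f \<in> abel_universal_wrt w r"
    then have "f \<circ> \<Phi> \<in> abel_universal_wrt w r"
      by (rule abel_universal_wrt_cong[OF assms(1), rotated]) (use id assms(2) in auto)
    then show "f \<circ> \<Phi> \<in> abel_universal w" using assms(1) by (auto simp: abel_universal_def)
  qed
next
  assume H: "\<forall>f \<in> abel_universal_wrt w r. f \<circ> \<Phi> \<in> abel_universal w"
  have w: "norm w < 1" "w \<noteq> 0" using assms(2) by auto
  have r1: "r n < 1" "0 \<le> r n" for n using assms(1) by (auto simp: abel_radii_def)
  obtain \<Psi> where cont: "continuous_on (cball 0 1) \<Psi>" and \<Psi>: "\<And>z. norm z < 1 \<Longrightarrow> \<Psi> z = \<Phi> z"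
    using assms(5) by auto
  have hol: "\<Psi> holomorphic_on ball 0 1"
    by (rule holomorphic_transform[OF assms(3)]) (simp add: \<Psi>)
  have lt1: "norm (\<Psi> z) < 1" if "norm z < 1" for z using that assms(4) \<Psi> by force
  have le1: "norm (\<Psi> z) \<le> 1" if "norm z \<le> 1" for z
  proof -
    have "\<Psi> ` closure (ball 0 1) \<subseteq> cball 0 1"
    proof (rule image_closure_subset)
      show "\<Psi> ` ball 0 1 \<subseteq> cball 0 1" using lt1 by (force intro: less_imp_le)
    qed (use cont in auto)
    then show ?thesis using that by (auto simp: image_subset_iff)
  qed
  have bd: "norm (\<Psi> \<zeta>) = 1" if \<zeta>: "norm \<zeta> = 1" for \<zeta>
  proof (rule ccontr)
    assume "norm (\<Psi> \<zeta>) \<noteq> 1"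
    then have in1: "norm (\<Psi> \<zeta>) < 1" using le1[of \<zeta>] \<zeta> by simp
    obtain m a b where "strict_mono m" "\<And>k. 0 < a k" "\<And>k. a k < r (m k)" "\<And>k. r (m k) < b k" "\<And>k. b k < a (Suc k)"
      by (rule shells_exist[OF assms(1) infinite_UNIV_nat, of "\<lambda>_. 1"]) auto
    then obtain f where f: "f \<in> abel_universal_wrt w r"
      using universal_bounded_between_shells[OF assms(1) w(1) norm_one, of m a b] by blast
    then have "isCont f (\<Psi> \<zeta>)"
      using in1 by (auto simp: abel_universal_wrt_def intro!: continuous_on_interior[OF holomorphic_on_imp_continuous_on])
    moreover have "(\<Psi> \<longlongrightarrow> \<Psi> \<zeta>) (at \<zeta> within ball 0 1)"
      using cont \<zeta> unfolding continuous_on_def by (rule_tac tendsto_within_subset[of _ _ _ "cball 0 1"]) auto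
    ultimately have "((\<lambda>z. f (\<Psi> z)) \<longlongrightarrow> f (\<Psi> \<zeta>)) (at \<zeta> within ball 0 1)"
      by (rule isCont_tendsto_compose)
    moreover have "\<forall>\<^sub>F z in at \<zeta> within ball 0 1. f (\<Psi> z) = (f \<circ> \<Phi>) z"
      using \<Psi> by (auto simp: eventually_at_filter)
    ultimately have "((f \<circ> \<Phi>) \<longlongrightarrow> f (\<Psi> \<zeta>)) (at \<zeta> within ball 0 1)"
      by (rule Lim_transform_eventually)
    then show False
      using abel_universal_no_boundary_limit[OF w(1) _ \<zeta>] H f by blast
  qed
  define \<eta>0 where "\<eta>0 = \<Psi> 1"
  have \<eta>0: "norm \<eta>0 = 1" unfolding \<eta>0_def by (rule bd) simp
  obtain \<delta> where \<delta>: "\<delta> > 0" "\<And>z. norm z \<le> 1 \<Longrightarrow> dist z 1 < \<delta> \<Longrightarrow> dist (\<Psi> z) \<eta>0 < (1 - norm w) / 2"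
    using cont w unfolding continuous_on_iff \<eta>0_def
    by (metis half_gt_zero diff_gt_0_iff_gt mem_cball_0 norm_one order_refl)
  have "\<delta> / 2 > 0" using \<delta> by simp
  then obtain K :: "complex set" where K: "compact K" "connected K" "infinite K" "K \<subseteq> sphere 0 1" "K \<noteq> sphere 0 1"
    "K \<subseteq> ball 1 (\<delta> / 2)" by (rule small_arc)
  have K1: "norm \<zeta> = 1" if "\<zeta> \<in> K" for \<zeta> using that K(4) by auto
  have abel_le1: "norm (abel_map w t \<zeta>) \<le> 1" if "t \<in> {0..1}" "\<zeta> \<in> K" for t \<zeta>
  proof (cases "t = 1")
    case True
    then show ?thesis using K1 that by (simp add: abel_map_def)
  next
    case False
    then show ?thesis using abel_map_in_disc[OF w(1) K1[OF that(2)], of t] that by simp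
  qed
  define bad where "bad n \<longleftrightarrow> (\<exists>t\<in>{0..1}. \<forall>\<zeta>\<in>K. \<Psi> (abel_map w t \<zeta>) \<in> sphere (abel_centre w (r n)) (r n))" for n
  have "finite {n. \<not> bad n}"
  proof (rule ccontr)
    assume I: "infinite {n. \<not> bad n}"
    have "\<exists>\<epsilon>>0. \<forall>t\<in>{0..1}. \<forall>a b. r n - \<epsilon> < a \<and> a < r n \<and> r n < b \<and> b < r n + \<epsilon> \<longrightarrow>
        (\<exists>\<zeta>\<in>K. \<Psi> (abel_map w t \<zeta>) \<notin> ball (abel_centre w b) b - cball (abel_centre w a) a)"
      if "n \<in> {n. \<not> bad n}" for n
    proof (rule shell_thickness)
      show "continuous_on {0..1} (\<lambda>t. \<Psi> (abel_map w t \<zeta>))" if "\<zeta> \<in> K" for \<zeta>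
        by (rule continuous_on_compose2[OF cont])
          (use abel_le1[OF _ that] in \<open>auto simp: abel_map_def intro!: continuous_intros\<close>)
    qed (use that in \<open>auto simp: bad_def\<close>)
    then obtain \<epsilon> where \<epsilon>: "\<And>n. n \<in> {n. \<not> bad n} \<Longrightarrow> \<epsilon> n > 0"
      "\<And>n t a b. n \<in> {n. \<not> bad n} \<Longrightarrow> t \<in> {0..1} \<Longrightarrow>
        r n - \<epsilon> n < a \<Longrightarrow> a < r n \<Longrightarrow> r n < b \<Longrightarrow> b < r n + \<epsilon> n \<Longrightarrow>
        \<exists>\<zeta>\<in>K. \<Psi> (abel_map w t \<zeta>) \<notin> ball (abel_centre w b) b - cball (abel_centre w a) a"
      by metis
    obtain m a b where m: "strict_mono m" "\<And>k. m k \<in> {n. \<not> bad n}"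
      and ab: "\<And>k. 0 < a k" "\<And>k. a k < r (m k)" "\<And>k. r (m k) < b k" "\<And>k. b k < a (Suc k)"
      and thin: "\<And>k. r (m k) - \<epsilon> (m k) < a k" "\<And>k. b k < r (m k) + \<epsilon> (m k)"
      by (rule shells_exist[OF assms(1) I \<epsilon>(1)]) auto
    define U where "U k = ball (abel_centre w (b k)) (b k) - cball (abel_centre w (a k)) (a k)" for k
    obtain f where f: "f \<in> abel_universal_wrt w r"
      and f2: "\<And>z. z \<in> ball 0 1 \<inter> cball \<eta>0 ((1 - norm w) / 2) \<Longrightarrow> (\<And>k. z \<notin> U k) \<Longrightarrow> norm (f z) \<le> 2"
      using universal_bounded_between_shells[OF assms(1) w(1) \<eta>0 m(1) ab] unfolding U_def by blast
    have "f \<circ> \<Phi> \<in> abel_universal w" using H f by blast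
    then obtain t where t: "1 - \<delta>/4 < t" "0 \<le> t" "t < 1"
      and ft: "\<And>\<zeta>. \<zeta> \<in> K \<Longrightarrow> norm ((f \<circ> \<Phi>) (abel_map w t \<zeta>) - 4) < 1"
      using abel_universal_approx_const[OF w(1) _ K(1,4,5), of "f \<circ> \<Phi>" 1 "1 - \<delta>/4" 4] \<delta>(1) by auto
    define Z where "Z = (\<lambda>\<zeta>. \<Psi> (abel_map w t \<zeta>)) ` K"
    have "connected Z" unfolding Z_def
      by (intro connected_continuous_image K continuous_on_compose2[OF cont])
        (use abel_le1[of t] t in \<open>auto simp: abel_map_def intro!: continuous_intros\<close>)
    moreover have "Z \<noteq> {}" using K(3) by (auto simp: Z_def)
    moreover have "Z \<subseteq> (\<Union>k. U k)"
    proof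
      fix y assume "y \<in> Z"
      then obtain \<zeta> where \<zeta>: "\<zeta> \<in> K" "y = \<Psi> (abel_map w t \<zeta>)" by (auto simp: Z_def)
      have in1: "norm (abel_map w t \<zeta>) < 1" by (rule abel_map_in_disc[OF w(1) K1[OF \<zeta>(1)] t(2,3)])
      have "dist (abel_map w t \<zeta>) \<zeta> < \<delta> / 2"
        using norm_abel_map_diff[OF w(1) K1[OF \<zeta>(1)], of t] t by (simp add: dist_norm)
      moreover have "dist \<zeta> 1 < \<delta> / 2" using K(6) \<zeta>(1) by (auto simp: dist_commute)
      ultimately have "dist (abel_map w t \<zeta>) 1 < \<delta>"
        using dist_triangle[of "abel_map w t \<zeta>" 1 \<zeta>] by simp
      then have "dist y \<eta>0 < (1 - norm w) / 2" using \<delta>(2) in1 \<zeta>(2) by simp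
      then have "y \<in> ball 0 1 \<inter> cball \<eta>0 ((1 - norm w) / 2)"
        using lt1[OF in1] \<zeta>(2) by (simp add: dist_commute)
      moreover have "\<not> norm (f y) \<le> 2"
      proof -
        have "norm (f y - 4) < 1" using ft[OF \<zeta>(1)] \<Psi>[OF in1] \<zeta>(2) by simp
        then show ?thesis using norm_triangle_ineq2[of 4 "4 - f y"] by (simp add: norm_minus_commute)
      qed
      ultimately show "y \<in> (\<Union>k. U k)" using f2 by blast
    qed
    moreover have "open (U k)" for k unfolding U_def by (intro open_Diff) auto
    moreover have lt: "U j \<inter> U k = {}" if "j < k" for j k
    proof -
      have mono: "strict_mono a" unfolding strict_mono_Suc_iff using ab by (meson less_trans)
      have "b j < a (Suc j)" by (rule ab)
      also have "a (Suc j) \<le> a k" using that by (intro monoD[OF strict_mono_mono[OF mono]]) simp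
      finally have "b j < a k" .
      then have "ball (abel_centre w (b j)) (b j) \<subseteq> cball (abel_centre w (a k)) (a k)"
        using abel_disc_nested[OF w(1), of "b j" "a k"] ball_subset_cball by blast
      then show ?thesis by (auto simp: U_def)
    qed
    then have "U j \<inter> U k = {}" if "j \<noteq> k" for j k
      using that by (metis Int_commute linorder_neqE_nat)
    ultimately obtain k where "Z \<subseteq> U k" by (rule connected_in_one_of_disjoint_opens)
    moreover have "\<exists>\<zeta>\<in>K. \<Psi> (abel_map w t \<zeta>) \<notin> U k"
      unfolding U_def by (rule \<epsilon>(2)[OF m(2) _ thin(1) ab(2) ab(3) thin(2)]) (use t in auto)
    ultimately show False by (auto simp: Z_def)
  qed
  then obtain N where N: "\<And>n. n > N \<Longrightarrow> bad n"
    by (metis (mono_tags, lifting) finite_nat_iff_bounded_le atMost_iff mem_Collect_eq not_le subsetD)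
  define S where "S = r ` {N<..}"
  have "\<forall>s\<in>S. \<exists>t\<in>{0..1}. \<forall>\<zeta>\<in>K. \<Psi> (abel_map w t \<zeta>) \<in> sphere (abel_centre w s) s"
    using N by (auto simp: S_def bad_def)
  then obtain \<tau> where \<tau>: "\<And>s. s \<in> S \<Longrightarrow> \<tau> s \<in> {0..1}"
    "\<And>s \<zeta>. s \<in> S \<Longrightarrow> \<zeta> \<in> K \<Longrightarrow> \<Psi> (abel_map w (\<tau> s) \<zeta>) \<in> sphere (abel_centre w s) s"
    by metis
  have S01: "0 \<le> s" "s < 1" if "s \<in> S" for s using that r1 by (auto simp: S_def)
  obtain \<zeta>0 where \<zeta>0: "\<zeta>0 \<in> K" using K(3) by (metis ex_in_conv finite.emptyI)
  have \<tau>1: "\<tau> s < 1" if s: "s \<in> S" for s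
  proof (rule ccontr)
    assume "\<not> \<tau> s < 1"
    then have "\<tau> s = 1" using \<tau>(1)[OF s] by simp
    then have "\<Psi> \<zeta>0 \<in> sphere (abel_centre w s) s" using \<tau>(2)[OF s \<zeta>0] by (simp add: abel_map_def)
    then have "norm (\<Psi> \<zeta>0) < 1" by (intro abel_disc_in_unit_disc[OF w(1) S01(2)[OF s]]) auto
    then show False using bd K1[OF \<zeta>0] by simp
  qed
  have inj: "inj_on \<tau> S"
  proof (rule linorder_inj_onI)
    fix s s' assume s: "s < s'" "s \<in> S" "s' \<in> S"
    show "\<tau> s \<noteq> \<tau> s'"
      using \<tau>(2)[OF s(2) \<zeta>0] \<tau>(2)[OF s(3) \<zeta>0] abel_disc_nested[OF w(1) s(1), of "\<Psi> (abel_map w (\<tau> s) \<zeta>0)"]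
      by auto
  qed auto
  have "infinite S"
  proof
    assume fin: "finite S"
    have "S \<noteq> {}" by (auto simp: S_def)
    then have "Max S < 1" using fin S01 by simp
    moreover have "r \<longlonglongrightarrow> 1" using assms(1) by (simp add: abel_radii_def)
    ultimately have "\<forall>\<^sub>F n in sequentially. Max S < r n \<and> n > N"
      by (intro eventually_conj eventually_gt_at_top) (simp add: order_tendsto_iff)
    from eventually_happens'[OF sequentially_bot this]
    obtain n where "Max S < r n" "n > N" by blast
    then show False using fin Max_ge[of S "r n"] by (auto simp: S_def)
  qed
  moreover have "finite (\<tau> -` {0} \<inter> S)" by (intro finite_vimage_IntI inj) simp
  ultimately have inf: "infinite (S - {0} - (\<tau> -` {0} \<inter> S))" by simp
  define S' where "S' = S - {0} - (\<tau> -` {0} \<inter> S)"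
  have S': "s \<in> S" "0 < s" "s < 1" "0 < \<tau> s" "\<tau> s < 1" if "s \<in> S'" for s
    using that S01[of s] \<tau>(1)[of s] \<tau>1[of s] by (auto simp: S'_def less_le)
  have "\<Psi> z = z" if z: "norm z < 1" for z
  proof (rule disc_map_identity_if_circles[OF w cont hol bd lt1, where \<tau> = \<tau> and S = S' and E = "\<lambda>s. abel_map w (\<tau> s) ` K"])
    show "infinite S'" using inf by (simp add: S'_def)
    show "inj_on \<tau> S'" using inj by (rule inj_on_subset) (auto simp: S'_def)
    fix s assume s: "s \<in> S'"
    have "inj_on (abel_map w (\<tau> s)) K" using S'[OF s] by (auto simp: inj_on_def abel_map_def)
    then show "infinite (abel_map w (\<tau> s) ` K)" using K(3) by (simp add: finite_image_iff)
    show "abel_map w (\<tau> s) ` K \<subseteq> ball 0 1"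
      using abel_map_in_disc[OF w(1) K1] S'[OF s] by auto
    show "abel_map w (\<tau> s) ` K \<subseteq> sphere (abel_centre w (\<tau> s)) (\<tau> s)"
      using abel_map_on_sphere[OF K1] S'(4)[OF s] by (auto simp del: mem_sphere simp: less_imp_le)
    show "\<Psi> ` abel_map w (\<tau> s) ` K \<subseteq> sphere (abel_centre w s) s"
      using \<tau>(2) S'(1)[OF s] by (auto simp del: mem_sphere)
  qed (use S' z in auto)
  then show "\<forall>z\<in>ball 0 1. \<Phi> z = z" using \<Psi> by auto
qed

end
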